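(* Let $G$ be a finite group and let $\mathcal{A}=\{A_nG\}_{n=0}^{+\infty}$ be a sequence of $G$-spaces such that for all $p$ and $q$ there is a $G$-equivariant map $A_pG\ast A_qG\to A_{p+q+1}G$. Let $P$ be a finite (not necessarily free) $G$-poset, let $P_0\subset P$ be an initial, $G$-invariant subposet, and let $P_1=P\setminus P_0$ be the complementary subposet. Let $\mathcal{D}:P\to Top$ be a $G$-diagram of spaces, with $G$-action on $\mathcal{D}$ compatible with the action on $P$, and let $\mathcal{D}_0$ and $\mathcal{D}_1$ be the restrictions of $\mathcal{D}$ to $P_0$ and $P_1$ respectively. Then $$\mathrm{Ind}_G^{\mathcal{A}}(\|\mathcal{D}_0\|)\ \ge\ \mathrm{Ind}_G^{\mathcal{A}}(\|\mathcal{D}\|)-\mathrm{Ind}_G^{\mathcal{A}}(\|\mathcal{D}_1\|)-1,$$ where $\|\mathcal{E}\|=\mathbf{hocolim}(\mathcal{E})$ denotes the homotopy colimit of a diagram $\mathcal{E}$.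
   Context: Index. For a $G$-space $X$, $\mathrm{Ind}_G^{\mathcal{A}}(X)=\inf\{n\in\mathbb{N}\mid \text{there is a } G\text{-equivariant (continuous) map } X\to A_nG\}$, where $\mathbb{N}$ includes $0$. $X\ast Y$ denotes the join, with the diagonal $G$-action. Diagrams. A diagram of spaces $\mathcal{D}$ over a finite poset $P$ assigns to each $p\in P$ a space $D_p$ and to each pair $p\le q$ a continuous map $d_{pq}:D_q\to D_p$ such that $d_{pp}=\mathbf{1}_{D_p}$ and $d_{pq}\circ d_{qr}=d_{pr}$ for $p\le q\le r$. A subposet $P_0\subset P$ is initial if $q\in P_0$ and $p\le q$ imply $p\in P_0$. A $G$-poset is a poset on which $G$ acts by order automorphisms. A $G$-diagram over a $G$-poset $P$ is a diagram with continuous maps $g:D_p\to D_{gp}$ for each $g\in G$, $p\in P$, which define a $G$-action on $\coprod_{p} D_p$ and commute with the structure maps: $g\circ d_{pq}=d_{gp,gq}\circ g$. Homotopy colimit. $\mathbf{hocolim}(\mathcal{D})$ is the quotient of $\coprod_{p\in P}\Delta(P_{\le p})\times D_p$ by the identifications, for all $p\le q$, $\lambda\in\Delta(P_{\le p})\subset\Delta(P_{\le q})$ and $y\in D_q$: $(\lambda,y)\in\Delta(P_{\le q})\times D_q$ is identified with $(\lambda,d_{pq}(y))\in\Delta(P_{\le p})\times D_p$. Here $\Delta(Q)$ is the order complex of a poset $Q$. Equivalently, it is the order complex of the topological poset $P_{\mathcal{D}}=\coprod_{p\in P}D_p$ with $(p,x)\preceq(q,y)$ iff $p\le q$ and $d_{pq}(y)=x$.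 For a $G$-diagram, $G$ acts naturally on the homotopy colimit. *)

theory Defs
  imports
    "HOL-Analysis.Analysis"
    "HOL-Algebra.Group_Action"
    "HOL-Library.Extended_Nat"
begin

section \<open>Quotients and binary coproducts of spaces\<close>

definition generated_equiv :: "'a set \<Rightarrow> ('a \<times> 'a) set \<Rightarrow> ('a \<times> 'a) set" where
  "generated_equiv S r = Restr ((Restr r S \<union> (Restr r S)\<inverse>)\<^sup>*) S"

lemma equiv_generated_equiv: "equiv S (generated_equiv S r)"
proof (rule equivI)
  have "sym ((Restr r S \<union> (Restr r S)\<inverse>)\<^sup>*)"
    by (rule sym_rtrancl) (auto simp: sym_def)
  then show "sym (generated_equiv S r)"
    by (auto simp: generated_equiv_def sym_def)
  show "trans (generated_equiv S r)"
    by (auto simp: generated_equiv_def trans_def)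
qed (auto simp: generated_equiv_def refl_on_def)

text \<open>The points of the quotient are the equivalence classes themselves.\<close>

definition quotient_space :: "'a topology \<Rightarrow> ('a \<times> 'a) set \<Rightarrow> 'a set topology" where
  "quotient_space X r =
     topology (\<lambda>\<U>. \<U> \<subseteq> topspace X // generated_equiv (topspace X) r \<and> openin X (\<Union>\<U>))"

lemma openin_quotient_space:
  "openin (quotient_space X r) \<U> \<longleftrightarrow>
     \<U> \<subseteq> topspace X // generated_equiv (topspace X) r \<and> openin X (\<Union>\<U>)"
proof -
  let ?Q = "topspace X // generated_equiv (topspace X) r"
  have Int: "\<Union>(\<U> \<inter> \<V>) = \<Union>\<U> \<inter> \<Union>\<V>" if "\<U> \<subseteq> ?Q" "\<V> \<subseteq> ?Q" for \<U> \<V>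
  proof
    show "\<Union>\<U> \<inter> \<Union>\<V> \<subseteq> \<Union>(\<U> \<inter> \<V>)"
    proof
      fix x assume "x \<in> \<Union>\<U> \<inter> \<Union>\<V>"
      then obtain A B where AB: "A \<in> \<U>" "x \<in> A" "B \<in> \<V>" "x \<in> B" by blast
      moreover have "A = B"
        using quotient_disj[OF equiv_generated_equiv, of A "topspace X" r B] AB that by blast
      ultimately show "x \<in> \<Union>(\<U> \<inter> \<V>)" by blast
    qed
  qed blast
  have "istopology (\<lambda>\<U>. \<U> \<subseteq> ?Q \<and> openin X (\<Union>\<U>))"
    unfolding istopology_def
  proof (intro conjI allI impI; (elim conjE)?)
    fix \<U> \<V> assume "\<U> \<subseteq> ?Q" "openin X (\<Union>\<U>)" "\<V> \<subseteq> ?Q" "openin X (\<Union>\<V>)"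
    then show "openin X (\<Union>(\<U> \<inter> \<V>))" by (simp add: Int openin_Int)
  next
    fix \<K> assume K: "\<forall>\<U>\<in>\<K>. \<U> \<subseteq> ?Q \<and> openin X (\<Union>\<U>)"
    have "openin X (\<Union>\<U>\<in>\<K>. \<Union>\<U>)" using K by (intro openin_clauses(3)) auto
    moreover have "(\<Union>\<U>\<in>\<K>. \<Union>\<U>) = \<Union>(\<Union>\<K>)" by blast
    ultimately show "openin X (\<Union>(\<Union>\<K>))" by simp
  qed blast+
  then show ?thesis by (simp add: quotient_space_def)
qed

lemma topspace_quotient_space:
  "topspace (quotient_space X r) = topspace X // generated_equiv (topspace X) r"
proof -
  have "openin (quotient_space X r) (topspace X // generated_equiv (topspace X) r)"
    by (simp add: openin_quotient_space Union_quotient[OF equiv_generated_equiv])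
  then have "topspace X // generated_equiv (topspace X) r \<subseteq> topspace (quotient_space X r)"
    by (rule openin_subset)
  moreover have "openin (quotient_space X r) (topspace (quotient_space X r))"
    by (rule openin_topspace)
  then have "topspace (quotient_space X r) \<subseteq> topspace X // generated_equiv (topspace X) r"
    unfolding openin_quotient_space by (rule conjunct1)
  ultimately show ?thesis by (rule subset_antisym[rotated])
qed

definition coproduct_space :: "'a topology \<Rightarrow> 'b topology \<Rightarrow> ('a + 'b) topology" where
  "coproduct_space X Y = topology (\<lambda>U. openin X (Inl -` U) \<and> openin Y (Inr -` U))"

lemma openin_coproduct_space:
  "openin (coproduct_space X Y) U \<longleftrightarrow> openin X (Inl -` U) \<and> openin Y (Inr -` U)"
proof -
  have "istopology (\<lambda>U. openin X (Inl -` U) \<and> openin Y (Inr -` U))"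
    by (auto simp: istopology_def vimage_Union)
  then show ?thesis by (simp add: coproduct_space_def)
qed

lemma topspace_coproduct_space: "topspace (coproduct_space X Y) = topspace X <+> topspace Y"
proof
  have "openin (coproduct_space X Y) (topspace X <+> topspace Y)"
    by (simp add: openin_coproduct_space vimage_def Plus_def image_iff)
  then show "topspace X <+> topspace Y \<subseteq> topspace (coproduct_space X Y)"
    by (rule openin_subset)
  have "openin (coproduct_space X Y) (topspace (coproduct_space X Y))" by simp
  then have L: "Inl -` topspace (coproduct_space X Y) \<subseteq> topspace X"
    and R: "Inr -` topspace (coproduct_space X Y) \<subseteq> topspace Y"
    unfolding openin_coproduct_space by (simp_all only: openin_subset)
  show "topspace (coproduct_space X Y) \<subseteq> topspace X <+> topspace Y"
  proof
    fix z assume "z \<in> topspace (coproduct_space X Y)"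
    then show "z \<in> topspace X <+> topspace Y"
      using L R by (cases z) (auto simp del: openin_topspace)
  qed
qed


section \<open>Spaces with a group action, and the index\<close>

text \<open>
  The locale \<^locale>\<open>group_action\<close> asks for the acting bijections to be extensional; the restriction
  makes the values of \<open>\<phi> g\<close> outside the space irrelevant.
\<close>

definition G_space ::
  "('g, 'm) monoid_scheme \<Rightarrow> 'a topology \<Rightarrow> ('g \<Rightarrow> 'a \<Rightarrow> 'a) \<Rightarrow> bool" where
  "G_space G X \<phi> \<longleftrightarrow>
     group_action G (topspace X) (\<lambda>g. restrict (\<phi> g) (topspace X)) \<and>
     (\<forall>g\<in>carrier G. continuous_map X X (\<phi> g))"

definition G_map ::
  "('g, 'm) monoid_scheme \<Rightarrow> 'a topology \<Rightarrow> ('g \<Rightarrow> 'a \<Rightarrow> 'a) \<Rightarrow>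
   'b topology \<Rightarrow> ('g \<Rightarrow> 'b \<Rightarrow> 'b) \<Rightarrow> ('a \<Rightarrow> 'b) \<Rightarrow> bool" where
  "G_map G X \<phi> Y \<psi> f \<longleftrightarrow>
     continuous_map X Y f \<and> (\<forall>g\<in>carrier G. \<forall>x\<in>topspace X. f (\<phi> g x) = \<psi> g (f x))"

text \<open>The infimum is taken in \<^typ>\<open>enat\<close>: the index is \<open>\<infinity>\<close> if there is no equivariant map at all.\<close>

definition Ind ::
  "('g, 'm) monoid_scheme \<Rightarrow> (nat \<Rightarrow> 'a topology) \<Rightarrow> (nat \<Rightarrow> 'g \<Rightarrow> 'a \<Rightarrow> 'a) \<Rightarrow>
   'x topology \<Rightarrow> ('g \<Rightarrow> 'x \<Rightarrow> 'x) \<Rightarrow> enat" where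
  "Ind G A \<alpha> X \<phi> = Inf {enat n | n. \<exists>f. G_map G X \<phi> (A n) (\<alpha> n) f}"


section \<open>Joins\<close>

text \<open>
  \<open>X * Y\<close> is the quotient of \<open>X \<squnion> Y \<squnion> (X \<times> Y \<times> [0,1])\<close> by \<open>(x, y, 0) \<sim> x\<close> and \<open>(x, y, 1) \<sim> y\<close>.
  For nonempty \<open>X\<close> and \<open>Y\<close> this is the usual quotient of \<open>X \<times> Y \<times> [0,1]\<close>; the two extra summands
  ensure \<open>X * \<emptyset> = X\<close> and \<open>\<emptyset> * Y = Y\<close>.
\<close>

type_synonym ('a, 'b) join_point = "(('a + 'b) + 'a \<times> 'b \<times> real) set"

definition join_rel ::
  "'a topology \<Rightarrow> 'b topology \<Rightarrow>
   ((('a + 'b) + 'a \<times> 'b \<times> real) \<times> (('a + 'b) + 'a \<times> 'b \<times> real)) set" where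
  "join_rel X Y =
     {(Inr (x, y, 0), Inl (Inl x)) | x y. x \<in> topspace X \<and> y \<in> topspace Y} \<union>
     {(Inr (x, y, 1), Inl (Inr y)) | x y. x \<in> topspace X \<and> y \<in> topspace Y}"

definition join_space :: "'a topology \<Rightarrow> 'b topology \<Rightarrow> ('a, 'b) join_point topology" where
  "join_space X Y =
     quotient_space
       (coproduct_space (coproduct_space X Y)
          (prod_topology X (prod_topology Y (top_of_set {0..1}))))
       (join_rel X Y)"

text \<open>The diagonal action \<open>g [x, y, t] = [g x, g y, t]\<close>; the image of a class is again a class.\<close>

definition join_action ::
  "('g \<Rightarrow> 'a \<Rightarrow> 'a) \<Rightarrow> ('g \<Rightarrow> 'b \<Rightarrow> 'b) \<Rightarrow> 'g \<Rightarrow> ('a, 'b) join_point \<Rightarrow> ('a, 'b) join_point" where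
  "join_action \<phi> \<psi> g C =
     map_sum (map_sum (\<phi> g) (\<psi> g)) (\<lambda>(x, y, t). (\<phi> g x, \<psi> g y, t)) ` C"


section \<open>Posets and diagrams with a group action\<close>

definition G_poset ::
  "('g, 'm) monoid_scheme \<Rightarrow> 'p::order set \<Rightarrow> ('g \<Rightarrow> 'p \<Rightarrow> 'p) \<Rightarrow> bool" where
  "G_poset G P \<psi> \<longleftrightarrow>
     group_action G P (\<lambda>g. restrict (\<psi> g) P) \<and>
     (\<forall>g\<in>carrier G. \<forall>p\<in>P. \<forall>q\<in>P. \<psi> g p \<le> \<psi> g q \<longleftrightarrow> p \<le> q)"

definition initial_subposet :: "'p::order set \<Rightarrow> 'p set \<Rightarrow> bool" where
  "initial_subposet P P0 \<longleftrightarrow> P0 \<subseteq> P \<and> (\<forall>q\<in>P0. \<forall>p\<in>P. p \<le> q \<longrightarrow> p \<in> P0)"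

text \<open>Structure maps go downwards: \<open>d p q\<close> maps \<open>D q\<close> to \<open>D p\<close> for \<open>p \<le> q\<close>.\<close>

definition diagram ::
  "'p::order set \<Rightarrow> ('p \<Rightarrow> 'x topology) \<Rightarrow> ('p \<Rightarrow> 'p \<Rightarrow> 'x \<Rightarrow> 'x) \<Rightarrow> bool" where
  "diagram P D d \<longleftrightarrow>
     (\<forall>p\<in>P. \<forall>q\<in>P. p \<le> q \<longrightarrow> continuous_map (D q) (D p) (d p q)) \<and>
     (\<forall>p\<in>P. \<forall>x\<in>topspace (D p). d p p x = x) \<and>
     (\<forall>p\<in>P. \<forall>q\<in>P. \<forall>r\<in>P. p \<le> q \<longrightarrow> q \<le> r \<longrightarrow>
        (\<forall>x\<in>topspace (D r). d p q (d q r x) = d p r x))"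

text \<open>\<open>\<gamma> g p\<close> is the map \<open>g : D p \<rightarrow> D (g p)\<close>.\<close>

definition G_diagram ::
  "('g, 'm) monoid_scheme \<Rightarrow> 'p::order set \<Rightarrow> ('g \<Rightarrow> 'p \<Rightarrow> 'p) \<Rightarrow>
   ('p \<Rightarrow> 'x topology) \<Rightarrow> ('p \<Rightarrow> 'p \<Rightarrow> 'x \<Rightarrow> 'x) \<Rightarrow> ('g \<Rightarrow> 'p \<Rightarrow> 'x \<Rightarrow> 'x) \<Rightarrow> bool" where
  "G_diagram G P \<psi> D d \<gamma> \<longleftrightarrow>
     diagram P D d \<and>
     (\<forall>g\<in>carrier G. \<forall>p\<in>P. continuous_map (D p) (D (\<psi> g p)) (\<gamma> g p)) \<and>
     group_action G (topspace (sum_topology D P))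
       (\<lambda>g. restrict (\<lambda>(p, x). (\<psi> g p, \<gamma> g p x)) (topspace (sum_topology D P))) \<and>
     (\<forall>g\<in>carrier G. \<forall>p\<in>P. \<forall>q\<in>P. p \<le> q \<longrightarrow>
        (\<forall>y\<in>topspace (D q). \<gamma> g p (d p q y) = d (\<psi> g p) (\<psi> g q) (\<gamma> g q y)))"


section \<open>Order complexes and homotopy colimits\<close>

text \<open>
  Points of the order complex are given by barycentric coordinates, extended by \<open>0\<close> outside \<open>Q\<close>, so
  that the order complex of a subposet is literally a subspace.  The topology is the usual one for
  finite \<open>Q\<close>, the only case needed (for infinite \<open>Q\<close> it is not the weak topology).
\<close>

definition order_complex :: "'p::order set \<Rightarrow> ('p \<Rightarrow> real) topology" where
  "order_complex Q =
     subtopology (powertop_real UNIV)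
       {w. (\<forall>p. 0 \<le> w p) \<and> {p. w p \<noteq> 0} \<subseteq> Q \<and>
           Complete_Partial_Order.chain (\<le>) {p. w p \<noteq> 0} \<and> sum w {p. w p \<noteq> 0} = 1}"

type_synonym ('p, 'x) hocolim_point = "('p \<times> ('p \<Rightarrow> real) \<times> 'x) set"

definition hocolim_rel ::
  "'p::order set \<Rightarrow> ('p \<Rightarrow> 'x topology) \<Rightarrow> ('p \<Rightarrow> 'p \<Rightarrow> 'x \<Rightarrow> 'x) \<Rightarrow>
   (('p \<times> ('p \<Rightarrow> real) \<times> 'x) \<times> ('p \<times> ('p \<Rightarrow> real) \<times> 'x)) set" where
  "hocolim_rel P D d =
     {((q, w, y), (p, w, d p q y)) | p q w y.
        p \<in> P \<and> q \<in> P \<and> p \<le> q \<and> w \<in> topspace (order_complex {r \<in> P. r \<le> p}) \<and>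
        y \<in> topspace (D q)}"

definition hocolim ::
  "'p::order set \<Rightarrow> ('p \<Rightarrow> 'x topology) \<Rightarrow> ('p \<Rightarrow> 'p \<Rightarrow> 'x \<Rightarrow> 'x) \<Rightarrow>
   ('p, 'x) hocolim_point topology" where
  "hocolim P D d =
     quotient_space
       (sum_topology (\<lambda>p. prod_topology (order_complex {r \<in> P. r \<le> p}) (D p)) P)
       (hocolim_rel P D d)"

text \<open>
  The action \<open>g [p, w, x] = [g p, g w, g x]\<close>, where \<open>g w\<close> has coordinates
  \<open>(g w) q = w (g\<inverse> q)\<close>; the image of a class is again a class.
\<close>

definition hocolim_action ::
  "('g, 'm) monoid_scheme \<Rightarrow> 'p set \<Rightarrow> ('g \<Rightarrow> 'p \<Rightarrow> 'p) \<Rightarrow> ('g \<Rightarrow> 'p \<Rightarrow> 'x \<Rightarrow> 'x) \<Rightarrow>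
   'g \<Rightarrow> ('p, 'x) hocolim_point \<Rightarrow> ('p, 'x) hocolim_point" where
  "hocolim_action G P \<psi> \<gamma> g C =
     (\<lambda>(p, w, x). (\<psi> g p, (\<lambda>q. if q \<in> P then w (\<psi> (inv\<^bsub>G\<^esub> g) q) else 0), \<gamma> g p x)) ` C"

end

theory Submission
  imports Defs
begin

text \<open>
  Let \<open>f\<^sub>0 : \<parallel>D\<^sub>0\<parallel> \<rightarrow> A\<^sub>m\<close> and \<open>f\<^sub>1 : \<parallel>D\<^sub>1\<parallel> \<rightarrow> A\<^sub>n\<close> be equivariant. A point \<open>[p, w, x]\<close> of \<open>\<parallel>D\<parallel>\<close> splits: restrict
  the barycentric coordinates \<open>w\<close> to \<open>P\<^sub>i\<close>, normalise, and push \<open>x\<close> down to the largest vertex of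
  \<open>P\<^sub>i\<close> carrying weight. This gives a point of \<open>\<parallel>D\<^sub>i\<parallel>\<close>, defined where \<open>w\<close> has weight on \<open>P\<^sub>i\<close>, and
  \<open>[f\<^sub>0, f\<^sub>1, w(P\<^sub>1)]\<close> is a point of \<open>A\<^sub>m * A\<^sub>n\<close>; compose with \<open>A\<^sub>m * A\<^sub>n \<rightarrow> A\<^bsub>m+n+1\<^esub>\<close>. The choice of the largest
  vertex makes this compatible with the identifications and the action. For continuity,
  cover each \<open>\<Delta>(P\<^bsub>\<le>p\<^esub>) \<times> D\<^sub>p\<close> by the finitely many closed pieces \<open>\<Delta>(c) \<times> D\<^sub>p\<close> over chains \<open>c\<close>; on
  each, the largest vertices can be replaced by those of \<open>c \<inter> P\<^sub>0\<close> and \<open>c \<inter> P\<^sub>1\<close>, which are constant.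
\<close>

section \<open>Quotients and coproducts\<close>

abbreviation quot_class :: "'a topology \<Rightarrow> ('a \<times> 'a) set \<Rightarrow> 'a \<Rightarrow> 'a set" where
  "quot_class X r z \<equiv> generated_equiv (topspace X) r `` {z}"

text \<open>Equivalent points are joined by a finite zigzag of steps of \<open>r\<close> inside
  \<open>S\<close>, taken forwards or backwards, and no step changes \<open>F\<close>. Hence
  functions on a quotient need checking on generators only.\<close>

lemma generated_equiv_invariant:
  assumes "(z, z') \<in> generated_equiv S r"
    and "\<And>a b. (a, b) \<in> r \<Longrightarrow> a \<in> S \<Longrightarrow> b \<in> S \<Longrightarrow> F a = F b"
  shows "F z = F z'"
proof -
  have "(z, z') \<in> (Restr r S \<union> (Restr r S)\<inverse>)\<^sup>*"
    using assms(1) by (simp add: generated_equiv_def)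
  then show ?thesis
  proof (induction rule: rtrancl_induct)
    case (step y z')
    then have "F y = F z'" using assms(2)[of y z'] assms(2)[of z' y] by auto
    with step.IH show ?case by simp
  qed simp
qed

lemma quot_class_eqI:
  assumes "(a, b) \<in> r" "a \<in> topspace X" "b \<in> topspace X"
  shows "quot_class X r a = quot_class X r b"
proof -
  have "(a, b) \<in> generated_equiv (topspace X) r"
    using assms by (auto simp: generated_equiv_def)
  then show ?thesis
    by (rule equiv_class_eq[OF equiv_generated_equiv])
qed

lemma quot_class_self: "z \<in> topspace X \<Longrightarrow> z \<in> quot_class X r z"
  using equiv_class_self[OF equiv_generated_equiv] .

lemma quot_class_subset: "quot_class X r z \<subseteq> topspace X"
  by (auto simp: generated_equiv_def)

text \<open>The preimage of a set \<open>U\<close> of classes is the union of its members, so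
  openness as defined for \<open>quotient_space\<close> is openness of the preimage.\<close>

lemma quotient_map_quot_class: "quotient_map X (quotient_space X r) (quot_class X r)"
proof -
  have eq: "{x \<in> topspace X. quot_class X r x \<in> U} = \<Union>U"
    if "U \<subseteq> topspace X // generated_equiv (topspace X) r" for U
  proof (intro equalityI subsetI)
    fix x assume "x \<in> {x \<in> topspace X. quot_class X r x \<in> U}"
    then show "x \<in> \<Union>U" using quot_class_self[of x X r] by blast
  next
    fix x assume "x \<in> \<Union>U"
    then obtain C where C: "C \<in> U" "x \<in> C" by blast
    then have "C \<in> topspace X // generated_equiv (topspace X) r" using that by blast
    then obtain z where z: "C = quot_class X r z" "z \<in> topspace X" by (rule quotientE)
    then have "(z, x) \<in> generated_equiv (topspace X) r" using C by simp
    then have "C = quot_class X r x"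
      unfolding z(1) by (rule equiv_class_eq[OF equiv_generated_equiv])
    moreover have "x \<in> topspace X" using C(2) quot_class_subset[of X r z] unfolding z(1) by (rule rev_subsetD)
    ultimately show "x \<in> {x \<in> topspace X. quot_class X r x \<in> U}"
      using C(1) by simp
  qed
  show ?thesis
    unfolding quotient_map_def topspace_quotient_space openin_quotient_space
  proof (intro conjI allI impI)
    show "quot_class X r ` topspace X = topspace X // generated_equiv (topspace X) r"
      unfolding quotient_def by (rule UNION_singleton_eq_range[symmetric])
  qed (simp add: eq)
qed

text \<open>Descends a function to classes by evaluating it at an arbitrary representative; it is
  meaningful for functions that are constant on classes.\<close>

definition lift :: "('a \<Rightarrow> 'b) \<Rightarrow> 'a set \<Rightarrow> 'b" where
  "lift F C = F (SOME z. z \<in> C)"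

lemma lift_quot_class:
  assumes "z \<in> topspace X"
    and "\<And>a b. (a, b) \<in> r \<Longrightarrow> a \<in> topspace X \<Longrightarrow> b \<in> topspace X \<Longrightarrow> F a = F b"
  shows "lift F (quot_class X r z) = F z"
proof -
  have "(SOME y. y \<in> quot_class X r z) \<in> quot_class X r z"
    using quot_class_self[OF assms(1)] by (rule someI)
  then have "(z, SOME y. y \<in> quot_class X r z) \<in> generated_equiv (topspace X) r" by simp
  then have "F z = F (SOME y. y \<in> quot_class X r z)"
    by (rule generated_equiv_invariant[where F = F]) (rule assms(2))
  then show ?thesis
    unfolding lift_def by (rule sym)
qed

text \<open>The universal property of the quotient: composing \<open>lift F\<close> with the
  projection gives back \<open>F\<close> on the space.\<close>

lemma continuous_map_lift:
  assumes "continuous_map X Y F"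
    and "\<And>a b. (a, b) \<in> r \<Longrightarrow> a \<in> topspace X \<Longrightarrow> b \<in> topspace X \<Longrightarrow> F a = F b"
  shows "continuous_map (quotient_space X r) Y (lift F)"
proof (rule continuous_compose_quotient_map[OF quotient_map_quot_class])
  have "F z = (lift F \<circ> quot_class X r) z" if "z \<in> topspace X" for z
    unfolding o_apply by (rule lift_quot_class[where F = F, OF that assms(2), symmetric])
  with assms(1) show "continuous_map X Y (lift F \<circ> quot_class X r)"
    by (rule continuous_map_eq)
qed

text \<open>The actions on joins and homotopy colimits are defined by taking images of classes; this
  converts them into formulas on representatives. Both \<open>h\<close> and its inverse
  \<open>k\<close> respect the generators, so \<open>h\<close> gives one inclusion and
  \<open>k\<close> the other.\<close>

lemma image_quot_class:
  assumes h: "\<And>z. z \<in> topspace X \<Longrightarrow> h z \<in> topspace X \<and> k (h z) = z"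
    and k: "\<And>z. z \<in> topspace X \<Longrightarrow> k z \<in> topspace X \<and> h (k z) = z"
    and hr: "\<And>a b. (a, b) \<in> r \<Longrightarrow> a \<in> topspace X \<Longrightarrow> b \<in> topspace X \<Longrightarrow> (h a, h b) \<in> r"
    and kr: "\<And>a b. (a, b) \<in> r \<Longrightarrow> a \<in> topspace X \<Longrightarrow> b \<in> topspace X \<Longrightarrow> (k a, k b) \<in> r"
    and z: "z \<in> topspace X"
  shows "h ` quot_class X r z = quot_class X r (h z)"
proof -
  \<comment> \<open>Stated for a general \<open>f\<close> because it is applied once to
    \<open>h\<close> and once to \<open>k\<close>. The invariant function is the class of the image
    under \<open>f\<close>.\<close>
  have push: "f b \<in> quot_class X r (f a)"
    if b: "b \<in> quot_class X r a" and f: "\<And>z. z \<in> topspace X \<Longrightarrow> f z \<in> topspace X"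
      and r: "\<And>a b. (a, b) \<in> r \<Longrightarrow> a \<in> topspace X \<Longrightarrow> b \<in> topspace X \<Longrightarrow> (f a, f b) \<in> r"
    for f a b
  proof -
    have "(a, b) \<in> generated_equiv (topspace X) r" using b by simp
    then have "quot_class X r (f a) = quot_class X r (f b)"
      by (rule generated_equiv_invariant[where F = "\<lambda>a. quot_class X r (f a)"])
        (intro quot_class_eqI r f)
    moreover have "b \<in> topspace X" using b quot_class_subset[of X r a] by (rule rev_subsetD)
    ultimately show ?thesis using quot_class_self[OF f] by simp
  qed
  show ?thesis
  proof (intro equalityI subsetI)
    fix y assume "y \<in> h ` quot_class X r z"
    then obtain b where b: "y = h b" "b \<in> quot_class X r z" by (rule imageE)
    show "y \<in> quot_class X r (h z)"
      unfolding b(1) using b(2) by (rule push) (use h hr in \<open>simp_all\<close>)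
  next
    fix y assume y: "y \<in> quot_class X r (h z)"
    then have "k y \<in> quot_class X r (k (h z))" by (rule push) (use k kr in \<open>simp_all\<close>)
    then have "k y \<in> quot_class X r z" using h[OF z] by simp
    moreover have "y \<in> topspace X" using y quot_class_subset[of X r "h z"] by (rule rev_subsetD)
    then have "y = h (k y)" using k by simp
    ultimately show "y \<in> h ` quot_class X r z" by (rule rev_image_eqI)
  qed
qed

section \<open>Maps out of disjoint sums and into binary coproducts\<close>

lemma continuous_map_from_sum_topology:
  assumes "\<And>i. i \<in> I \<Longrightarrow> continuous_map (X i) Y (\<lambda>x. f (i, x))"
  shows "continuous_map (sum_topology X I) Y f"
  unfolding continuous_map_def
proof (intro conjI allI impI)
  show "f \<in> topspace (sum_topology X I) \<rightarrow> topspace Y"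
    using assms by (fastforce simp: continuous_map_def)
next
  fix U assume "openin Y U"
  then have "openin (X i) {x \<in> topspace (X i). f (i, x) \<in> U}" if "i \<in> I" for i
    using assms[OF that] by (simp add: continuous_map_def)
  then show "openin (sum_topology X I) {x \<in> topspace (sum_topology X I). f x \<in> U}"
    unfolding openin_sum_topology by (auto simp: Collect_conj_eq cong: conj_cong)
qed

lemma continuous_map_Inl: "continuous_map X (coproduct_space X Y) Inl"
  unfolding continuous_map_def
proof (intro conjI allI impI)
  fix U assume "openin (coproduct_space X Y) U"
  then have "openin X (topspace X \<inter> Inl -` U)"
    by (auto simp: openin_coproduct_space)
  then show "openin X {x \<in> topspace X. Inl x \<in> U}" by (simp add: Int_def vimage_def)
qed (auto simp: topspace_coproduct_space)

lemma continuous_map_Inr: "continuous_map Y (coproduct_space X Y) Inr"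
  unfolding continuous_map_def
proof (intro conjI allI impI)
  fix U assume "openin (coproduct_space X Y) U"
  then have "openin Y (topspace Y \<inter> Inr -` U)"
    by (auto simp: openin_coproduct_space)
  then show "openin Y {x \<in> topspace Y. Inr x \<in> U}" by (simp add: Int_def vimage_def)
qed (auto simp: topspace_coproduct_space)

section \<open>Joins\<close>

definition pre_join :: "'a topology \<Rightarrow> 'b topology \<Rightarrow> (('a + 'b) + 'a \<times> 'b \<times> real) topology" where
  "pre_join X Y = coproduct_space (coproduct_space X Y)
     (prod_topology X (prod_topology Y (top_of_set {0..1})))"

definition join_class ::
  "'a topology \<Rightarrow> 'b topology \<Rightarrow> ('a + 'b) + 'a \<times> 'b \<times> real \<Rightarrow> ('a, 'b) join_point" where
  "join_class X Y = quot_class (pre_join X Y) (join_rel X Y)"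

lemma continuous_map_join_class: "continuous_map (pre_join X Y) (join_space X Y) (join_class X Y)"
  unfolding join_class_def join_space_def pre_join_def[symmetric]
  by (rule quotient_imp_continuous_map[OF quotient_map_quot_class])

lemma topspace_pre_join:
  "topspace (pre_join X Y) = (topspace X <+> topspace Y) <+> topspace X \<times> topspace Y \<times> {0..1}"
  by (simp add: pre_join_def topspace_coproduct_space)

lemma join_class_0:
  "x \<in> topspace X \<Longrightarrow> y \<in> topspace Y \<Longrightarrow>
    join_class X Y (Inr (x, y, 0)) = join_class X Y (Inl (Inl x))"
  unfolding join_class_def
  by (rule quot_class_eqI) (auto simp: topspace_pre_join join_rel_def)

lemma join_class_1:
  "x \<in> topspace X \<Longrightarrow> y \<in> topspace Y \<Longrightarrow>
    join_class X Y (Inr (x, y, 1)) = join_class X Y (Inl (Inr y))"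
  unfolding join_class_def
  by (rule quot_class_eqI) (auto simp: topspace_pre_join join_rel_def)

section \<open>Group actions on spaces and on joins\<close>

lemma G_space_closed:
  "G_space G X \<phi> \<Longrightarrow> g \<in> carrier G \<Longrightarrow> x \<in> topspace X \<Longrightarrow> \<phi> g x \<in> topspace X"
  by (auto simp: G_space_def continuous_map_def)

lemma G_space_inv:
  assumes "G_space G X \<phi>" "g \<in> carrier G" "x \<in> topspace X"
  shows "\<phi> (inv\<^bsub>G\<^esub> g) (\<phi> g x) = x"
proof -
  interpret group_action G "topspace X" "\<lambda>g. restrict (\<phi> g) (topspace X)"
    using assms by (simp add: G_space_def)
  show ?thesis
    using orbit_sym_aux[OF assms(2,3) refl] assms G_space_closed[OF assms] by simp
qed

text \<open>On representatives \<open>g\<close> acts bijectively, with inverse the action of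
  \<open>inv g\<close>, and it leaves the join parameter alone, so it preserves
  \<open>join_rel\<close>; then \<open>image_quot_class\<close> applies.\<close>

lemma join_action_join_class:
  assumes "group G" "G_space G X \<phi>" "G_space G Y \<theta>" "g \<in> carrier G" "z \<in> topspace (pre_join X Y)"
  shows "join_action \<phi> \<theta> g (join_class X Y z) =
    join_class X Y (map_sum (map_sum (\<phi> g) (\<theta> g)) (\<lambda>(x, y, t). (\<phi> g x, \<theta> g y, t)) z)"
proof -
  interpret group G by fact
  note closed = G_space_closed[OF assms(2)] G_space_closed[OF assms(3)]
  note inv = G_space_inv[OF assms(2)] G_space_inv[OF assms(3)]
  let ?h = "\<lambda>g. map_sum (map_sum (\<phi> g) (\<theta> g)) (\<lambda>(x, y, t). (\<phi> g x, \<theta> g y, t))"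
  have h: "?h g z \<in> topspace (pre_join X Y) \<and> ?h (inv\<^bsub>G\<^esub> g) (?h g z) = z"
    if "g \<in> carrier G" "z \<in> topspace (pre_join X Y)" for g z
    using that by (auto simp: topspace_pre_join closed inv)
  have r: "(?h g a, ?h g b) \<in> join_rel X Y" if "g \<in> carrier G" "(a, b) \<in> join_rel X Y" for g a b
    using that by (auto simp: join_rel_def closed)
  show ?thesis
    unfolding join_action_def join_class_def
  proof (rule image_quot_class[where k = "?h (inv\<^bsub>G\<^esub> g)"])
    fix z assume z: "z \<in> topspace (pre_join X Y)"
    show "?h (inv\<^bsub>G\<^esub> g) z \<in> topspace (pre_join X Y) \<and> ?h g (?h (inv\<^bsub>G\<^esub> g) z) = z"
      using h[of "inv\<^bsub>G\<^esub> g" z] z assms(4) by simp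
  qed (use assms(4,5) h r in \<open>simp_all\<close>)
qed

section \<open>Order complexes\<close>

text \<open>For finite \<open>Q\<close> the sum over the support may be taken over \<open>Q\<close>,
  since only zeros are added. This gives a fixed index set for sums.\<close>

lemma order_complex_iff:
  assumes "finite Q"
  shows "w \<in> topspace (order_complex Q) \<longleftrightarrow>
    (\<forall>p. 0 \<le> w p) \<and> (\<forall>p. w p \<noteq> 0 \<longrightarrow> p \<in> Q) \<and>
    (\<forall>p q. w p \<noteq> 0 \<longrightarrow> w q \<noteq> 0 \<longrightarrow> p \<le> q \<or> q \<le> p) \<and> sum w Q = 1"
proof -
  have "sum w {p. w p \<noteq> 0} = sum w Q" if "{p. w p \<noteq> 0} \<subseteq> Q"
    using that assms by (intro sum.mono_neutral_left) auto
  then show ?thesis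
    unfolding order_complex_def chain_def by auto (simp_all add: subset_iff)
qed

lemma sum_order_complex:
  assumes "w \<in> topspace (order_complex Q)" "Q \<subseteq> R" "finite R"
  shows "sum w R = 1"
proof -
  have "finite Q" using assms finite_subset by blast
  then have "sum w Q = 1" "\<forall>p. w p \<noteq> 0 \<longrightarrow> p \<in> Q"
    using assms(1) order_complex_iff by blast+
  moreover have "sum w Q = sum w R"
    using assms calculation(2) by (intro sum.mono_neutral_left) auto
  ultimately show ?thesis by simp
qed

text \<open>Both complexes are subspaces of the same power of the reals, and the points of the
  smaller one satisfy the conditions of the larger one.\<close>

lemma order_complex_mono:
  assumes "Q \<subseteq> R"
  shows "order_complex Q = subtopology (order_complex R) (topspace (order_complex Q))"
  using assms unfolding order_complex_def subtopology_subtopology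
  by (intro arg_cong[where f = "subtopology _"]) auto

lemma Hausdorff_space_order_complex: "Hausdorff_space (order_complex Q)"
  unfolding order_complex_def
  by (intro Hausdorff_space_subtopology) (simp add: Hausdorff_space_product_topology)

text \<open>On a chain the comparability condition is automatic, so the complex is a full simplex: a
  closed subset of a cube, which is compact by Tychonoff.\<close>

lemma compact_space_order_complex_chain:
  fixes c :: "'p::order set"
  assumes "finite c" "Complete_Partial_Order.chain (\<le>) c"
  shows "compact_space (order_complex c)"
proof -
  define S :: "('p \<Rightarrow> real) set" where
    "S = {w. (\<forall>p. 0 \<le> w p) \<and> (\<forall>p. p \<notin> c \<longrightarrow> w p = 0) \<and> sum w c = 1}"
  have top: "topspace (order_complex c) = S"
    using assms(2) unfolding set_eq_iff order_complex_iff[OF assms(1)] S_def chain_def by auto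
  have "w p \<le> 1" if "w \<in> S" for w p
  proof (cases "p \<in> c")
    case True
    then have "w p \<le> sum w c" using that assms(1) by (intro member_le_sum) (auto simp: S_def)
    then show ?thesis using that by (simp add: S_def)
  qed (use that in \<open>simp add: S_def\<close>)
  then have sub: "S \<subseteq> (\<Pi>\<^sub>E i\<in>UNIV. {0..1})" by (auto simp: S_def)
  \<comment> \<open>Each set in this intersection is given by an equation or a weak inequality
    between continuous functions of the coordinates.\<close>
  have "S = (\<Inter>p. {w. 0 \<le> w p}) \<inter> (\<Inter>p\<in>-c. {w. w p = 0}) \<inter> {w. sum w c = 1}"
    by (auto simp: S_def)
  moreover have "closed \<dots>"
    by (intro closed_Int closed_INT ballI closed_Collect_le closed_Collect_eq continuous_intros
        continuous_on_product_coordinates)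
  ultimately have "closedin (powertop_real UNIV) S"
    by (simp add: euclidean_product_topology)
  moreover have "compactin (powertop_real (UNIV :: 'p set)) (\<Pi>\<^sub>E i\<in>UNIV. {0..1})"
    by (simp add: compactin_PiE)
  ultimately have "compactin (powertop_real UNIV) S"
    using sub closed_compactin by blast
  moreover have "order_complex c = subtopology (powertop_real UNIV) S"
    using top unfolding order_complex_def by (simp add: subtopology_restrict)
  ultimately show ?thesis by (simp add: compact_space_subtopology)
qed

text \<open>A compact subset of a Hausdorff space is closed. These simplices are the pieces over
  which continuity is pasted.\<close>

lemma closedin_order_complex_chain:
  assumes "finite c" "Complete_Partial_Order.chain (\<le>) c" "c \<subseteq> Q"
  shows "closedin (order_complex Q) (topspace (order_complex c))"
proof (rule compactin_imp_closedin[OF Hausdorff_space_order_complex])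
  have "compactin (order_complex c) (topspace (order_complex c))"
    using compact_space_order_complex_chain[OF assms(1,2)] by (simp add: compact_space_def)
  then show "compactin (order_complex Q) (topspace (order_complex c))"
    using order_complex_mono[OF assms(3)] by (metis compactin_subtopology)
qed

lemma continuous_map_order_complex_coordinate:
  "continuous_map (order_complex Q) euclideanreal (\<lambda>w. w p)"
  unfolding order_complex_def
  by (intro continuous_map_from_subtopology continuous_map_product_projection) simp

lemma continuous_map_into_order_complex:
  assumes "\<And>p. continuous_map X euclideanreal (\<lambda>x. f x p)"
    and "\<And>x. x \<in> topspace X \<Longrightarrow> f x \<in> topspace (order_complex Q)"
  shows "continuous_map X (order_complex Q) f"
  unfolding order_complex_def
  by (rule continuous_map_into_subtopology)
    (use assms in \<open>auto simp: continuous_map_componentwise_UNIV order_complex_def\<close>)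

text \<open>Meaningful only if \<open>w\<close> has nonzero weight on \<open>Q\<close>.\<close>

definition top_vertex :: "'p::order set \<Rightarrow> ('p \<Rightarrow> real) \<Rightarrow> 'p" where
  "top_vertex Q w = (GREATEST p. p \<in> Q \<and> w p \<noteq> 0)"

text \<open>The projection of a simplex to the face spanned by \<open>Q\<close>, away from the
  opposite face. If the weight on \<open>Q\<close> is \<open>0\<close>, division by zero yields the
  zero function, which is not a point of any order complex.\<close>

definition normalized_restriction :: "'p set \<Rightarrow> ('p \<Rightarrow> real) \<Rightarrow> 'p \<Rightarrow> real" where
  "normalized_restriction Q w = (\<lambda>p. if p \<in> Q then w p / sum w Q else 0)"

text \<open>The support of \<open>w\<close> inside \<open>Q\<close> is finite, nonempty because the
  weight is nonzero, and pairwise comparable. A maximal element of it is therefore greatest, and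
  \<open>GREATEST\<close> is well defined.\<close>

lemma top_vertex:
  assumes "finite R" "w \<in> topspace (order_complex R)" "finite Q" "sum w Q \<noteq> 0"
  shows "top_vertex Q w \<in> Q" "w (top_vertex Q w) \<noteq> 0" "top_vertex Q w \<in> R"
    "\<And>q. q \<in> Q \<Longrightarrow> w q \<noteq> 0 \<Longrightarrow> q \<le> top_vertex Q w"
proof -
  let ?S = "{q \<in> Q. w q \<noteq> 0}"
  have "finite ?S" using assms(3) by simp
  moreover have "?S \<noteq> {}" using assms(4) sum.neutral[of Q w] by blast
  ultimately obtain m where m: "m \<in> ?S" "\<And>b. b \<in> ?S \<Longrightarrow> m \<le> b \<Longrightarrow> m = b"
    using finite_has_maximal[of ?S] by auto
  have max: "q \<le> m" if "q \<in> ?S" for q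
    using assms(2) m that unfolding order_complex_iff[OF assms(1)] by blast
  have "top_vertex Q w = m"
    unfolding top_vertex_def by (rule Greatest_equality) (use m max in auto)
  moreover have "m \<in> R" using assms(2) m(1) unfolding order_complex_iff[OF assms(1)] by blast
  ultimately show "top_vertex Q w \<in> Q" "w (top_vertex Q w) \<noteq> 0" "top_vertex Q w \<in> R"
    "\<And>q. q \<in> Q \<Longrightarrow> w q \<noteq> 0 \<Longrightarrow> q \<le> top_vertex Q w"
    using m max by auto
qed

lemma top_vertex_eqI:
  assumes "m \<in> Q" "w m \<noteq> 0" "\<And>q. q \<in> Q \<Longrightarrow> w q \<noteq> 0 \<Longrightarrow> q \<le> m"
  shows "top_vertex Q w = m"
  unfolding top_vertex_def by (rule Greatest_equality) (use assms in auto)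

text \<open>All vertices of \<open>Q\<close> with weight lie below the top vertex, so the part of
  \<open>Q\<close> below it carries the whole of \<open>sum w Q\<close>, and dividing makes the
  total \<open>1\<close>.\<close>

lemma normalized_restriction_in_order_complex:
  assumes "finite R" "w \<in> topspace (order_complex R)" "finite Q" "sum w Q \<noteq> 0"
  shows "normalized_restriction Q w \<in> topspace (order_complex {r \<in> Q. r \<le> top_vertex Q w})"
proof -
  have w: "\<forall>p. 0 \<le> w p" "\<forall>p q. w p \<noteq> 0 \<longrightarrow> w q \<noteq> 0 \<longrightarrow> p \<le> q \<or> q \<le> p"
    using assms(2) unfolding order_complex_iff[OF assms(1)] by blast+
  have "sum (normalized_restriction Q w) {r \<in> Q. r \<le> top_vertex Q w} = sum (normalized_restriction Q w) Q"
    using assms(3) top_vertex(4)[OF assms]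
    by (intro sum.mono_neutral_left) (auto simp: normalized_restriction_def)
  also have "\<dots> = sum w Q / sum w Q"
    by (simp add: normalized_restriction_def flip: sum_divide_distrib)
  finally have sum: "sum (normalized_restriction Q w) {r \<in> Q. r \<le> top_vertex Q w} = 1"
    using assms(4) by simp
  have fin: "finite {r \<in> Q. r \<le> top_vertex Q w}" using assms(3) by simp
  show ?thesis
    unfolding order_complex_iff[OF fin]
  proof (intro conjI sum allI impI)
    fix p show "0 \<le> normalized_restriction Q w p"
      using w(1) by (simp add: normalized_restriction_def sum_nonneg)
    show "p \<in> {r \<in> Q. r \<le> top_vertex Q w}" if "normalized_restriction Q w p \<noteq> 0"
      using that top_vertex(4)[OF assms, of p]
      by (auto simp: normalized_restriction_def split: if_splits)
    fix q assume "normalized_restriction Q w p \<noteq> 0" "normalized_restriction Q w q \<noteq> 0"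
    then show "p \<le> q \<or> q \<le> p"
      using w(2) by (simp add: normalized_restriction_def split: if_splits)
  qed
qed

section \<open>Homotopy colimits\<close>

definition pre_hocolim ::
  "'p::order set \<Rightarrow> ('p \<Rightarrow> 'x topology) \<Rightarrow> ('p \<times> ('p \<Rightarrow> real) \<times> 'x) topology" where
  "pre_hocolim P D = sum_topology (\<lambda>p. prod_topology (order_complex {r \<in> P. r \<le> p}) (D p)) P"

definition hocolim_class ::
  "'p::order set \<Rightarrow> ('p \<Rightarrow> 'x topology) \<Rightarrow> ('p \<Rightarrow> 'p \<Rightarrow> 'x \<Rightarrow> 'x) \<Rightarrow>
    'p \<Rightarrow> ('p \<Rightarrow> real) \<Rightarrow> 'x \<Rightarrow> ('p, 'x) hocolim_point" where
  "hocolim_class P D d p w x = quot_class (pre_hocolim P D) (hocolim_rel P D d) (p, w, x)"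

lemma hocolim_eq: "hocolim P D d = quotient_space (pre_hocolim P D) (hocolim_rel P D d)"
  by (simp add: hocolim_def pre_hocolim_def)

lemma topspace_pre_hocolim_iff:
  "(p, w, x) \<in> topspace (pre_hocolim P D) \<longleftrightarrow>
    p \<in> P \<and> w \<in> topspace (order_complex {r \<in> P. r \<le> p}) \<and> x \<in> topspace (D p)"
  by (simp add: pre_hocolim_def)

lemma continuous_map_hocolim_class:
  assumes "p \<in> P"
  shows "continuous_map (prod_topology (order_complex {r \<in> P. r \<le> p}) (D p)) (hocolim P D d)
    (\<lambda>(w, x). hocolim_class P D d p w x)"
proof -
  have "continuous_map (prod_topology (order_complex {r \<in> P. r \<le> p}) (D p)) (pre_hocolim P D)
      (\<lambda>z. (p, z))"
    unfolding pre_hocolim_def by (rule continuous_map_component_injection) fact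
  from continuous_map_compose[OF this quotient_imp_continuous_map[OF quotient_map_quot_class]]
  show ?thesis
    unfolding hocolim_eq hocolim_class_def by (simp add: o_def case_prod_unfold)
qed

lemma hocolim_point_cases:
  assumes "C \<in> topspace (hocolim P D d)"
  obtains p w x where "C = hocolim_class P D d p w x" "p \<in> P"
    "w \<in> topspace (order_complex {r \<in> P. r \<le> p})" "x \<in> topspace (D p)"
proof -
  obtain z where z: "z \<in> topspace (pre_hocolim P D)"
      "C = quot_class (pre_hocolim P D) (hocolim_rel P D d) z"
    using assms unfolding hocolim_eq topspace_quotient_space by (rule quotientE) auto
  obtain p w x where "z = (p, w, x)" by (rule prod_cases3)
  with z show ?thesis using that by (simp add: topspace_pre_hocolim_iff hocolim_class_def)
qed

section \<open>Finite diagrams with a group action\<close>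

text \<open>A pointwise form of the hypotheses, free of restricted maps, which passes unchanged to
  every invariant subset of \<open>P\<close> and so serves \<open>P\<close>, \<open>P0\<close> and
  \<open>P1\<close> alike.\<close>

locale equivariant_diagram = group G
  for G :: "('g, 'm) monoid_scheme" (structure) +
  fixes P :: "'p::order set" and \<psi> :: "'g \<Rightarrow> 'p \<Rightarrow> 'p"
    and D :: "'p \<Rightarrow> 'x topology" and d :: "'p \<Rightarrow> 'p \<Rightarrow> 'x \<Rightarrow> 'x"
    and \<gamma> :: "'g \<Rightarrow> 'p \<Rightarrow> 'x \<Rightarrow> 'x"
  assumes finite_P: "finite P"
    and \<psi>_closed: "\<lbrakk>g \<in> carrier G; p \<in> P\<rbrakk> \<Longrightarrow> \<psi> g p \<in> P"
    and \<psi>_inv: "\<lbrakk>g \<in> carrier G; p \<in> P\<rbrakk> \<Longrightarrow> \<psi> (inv g) (\<psi> g p) = p"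
    and \<psi>_mono: "\<lbrakk>g \<in> carrier G; p \<in> P; q \<in> P; p \<le> q\<rbrakk> \<Longrightarrow> \<psi> g p \<le> \<psi> g q"
    and d_continuous: "\<lbrakk>p \<in> P; q \<in> P; p \<le> q\<rbrakk> \<Longrightarrow> continuous_map (D q) (D p) (d p q)"
    and d_id: "\<lbrakk>p \<in> P; x \<in> topspace (D p)\<rbrakk> \<Longrightarrow> d p p x = x"
    and d_comp: "\<lbrakk>p \<in> P; q \<in> P; r \<in> P; p \<le> q; q \<le> r; x \<in> topspace (D r)\<rbrakk> \<Longrightarrow>
      d p q (d q r x) = d p r x"
    and \<gamma>_closed: "\<lbrakk>g \<in> carrier G; p \<in> P; x \<in> topspace (D p)\<rbrakk> \<Longrightarrow> \<gamma> g p x \<in> topspace (D (\<psi> g p))"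
    and \<gamma>_inv: "\<lbrakk>g \<in> carrier G; p \<in> P; x \<in> topspace (D p)\<rbrakk> \<Longrightarrow> \<gamma> (inv g) (\<psi> g p) (\<gamma> g p x) = x"
    and \<gamma>_d: "\<lbrakk>g \<in> carrier G; p \<in> P; q \<in> P; p \<le> q; y \<in> topspace (D q)\<rbrakk> \<Longrightarrow>
      \<gamma> g p (d p q y) = d (\<psi> g p) (\<psi> g q) (\<gamma> g q y)"
begin

lemma d_closed: "\<lbrakk>p \<in> P; q \<in> P; p \<le> q; x \<in> topspace (D q)\<rbrakk> \<Longrightarrow> d p q x \<in> topspace (D p)"
  using d_continuous[of p q] by (auto simp: continuous_map_def)

lemma \<psi>_inv': "\<lbrakk>g \<in> carrier G; p \<in> P\<rbrakk> \<Longrightarrow> \<psi> g (\<psi> (inv g) p) = p"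
  using \<psi>_inv[of "inv g" p] by simp

text \<open>The generating identification read as an equation of classes; since
  \<open>p \<le> q\<close>, the point \<open>w\<close> also lies in the larger complex below
  \<open>q\<close>.\<close>

lemma hocolim_class_structure_map:
  assumes "p \<in> P" "q \<in> P" "p \<le> q" "w \<in> topspace (order_complex {r \<in> P. r \<le> p})"
    and "y \<in> topspace (D q)"
  shows "hocolim_class P D d p w (d p q y) = hocolim_class P D d q w y"
proof -
  have "{r \<in> P. r \<le> p} \<subseteq> {r \<in> P. r \<le> q}" using assms(3) by auto
  from order_complex_mono[OF this]
  have "topspace (order_complex {r \<in> P. r \<le> p}) \<subseteq> topspace (order_complex {r \<in> P. r \<le> q})"
    by (metis inf_le1 topspace_subtopology)
  then have "hocolim_class P D d q w y = hocolim_class P D d p w (d p q y)"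
    unfolding hocolim_class_def
    by (intro quot_class_eqI)
      (use assms d_closed in \<open>auto simp: topspace_pre_hocolim_iff hocolim_rel_def\<close>)
  then show ?thesis by (rule sym)
qed

text \<open>The middle component of \<open>hocolim_action\<close>. It depends on \<open>P\<close>:
  the version for an invariant subset, \<open>sub.act\<close> below, vanishes outside that
  subset.\<close>

definition act :: "'g \<Rightarrow> ('p \<Rightarrow> real) \<Rightarrow> 'p \<Rightarrow> real" where
  "act g w = (\<lambda>q. if q \<in> P then w (\<psi> (inv g) q) else 0)"

lemma act_\<psi>: "\<lbrakk>g \<in> carrier G; p \<in> P\<rbrakk> \<Longrightarrow> act g w (\<psi> g p) = w p"
  by (simp add: act_def \<psi>_closed \<psi>_inv)

lemma act_nonzero:
  assumes "g \<in> carrier G" "act g w q \<noteq> 0"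
  obtains p where "p \<in> P" "w p \<noteq> 0" "q = \<psi> g p"
proof
  show "\<psi> (inv g) q \<in> P" "w (\<psi> (inv g) q) \<noteq> 0" "q = \<psi> g (\<psi> (inv g) q)"
    using assms by (simp_all add: act_def \<psi>_closed \<psi>_inv' split: if_splits)
qed

text \<open>Reindexing, as \<open>\<psi> g\<close> permutes the invariant set \<open>Q\<close>. For
  \<open>P0\<close> and \<open>P1\<close> this makes the join parameter invariant under the
  action.\<close>

lemma sum_act:
  assumes "g \<in> carrier G" "Q \<subseteq> P" "\<And>h q. h \<in> carrier G \<Longrightarrow> q \<in> Q \<Longrightarrow> \<psi> h q \<in> Q"
  shows "sum (act g w) Q = sum w Q"
proof (rule sum.reindex_bij_witness[where i = "\<psi> g" and j = "\<psi> (inv g)"])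
qed (use assms \<psi>_inv \<psi>_inv' in \<open>auto simp: act_def subset_iff\<close>)

text \<open>The support of \<open>act g w\<close> is the translate by \<open>g\<close> of the
  support of \<open>w\<close>; as \<open>\<psi> g\<close> is monotone, it is again a chain and lies
  below \<open>\<psi> g p\<close>.\<close>

lemma act_in_order_complex:
  assumes "g \<in> carrier G" "p \<in> P" "w \<in> topspace (order_complex {r \<in> P. r \<le> p})"
  shows "act g w \<in> topspace (order_complex {r \<in> P. r \<le> \<psi> g p})"
proof -
  have fin: "finite {r \<in> P. r \<le> q}" for q using finite_P by simp
  have w: "\<forall>p. 0 \<le> w p" "\<And>q. w q \<noteq> 0 \<Longrightarrow> q \<in> P \<and> q \<le> p"
    "\<And>p q. w p \<noteq> 0 \<Longrightarrow> w q \<noteq> 0 \<Longrightarrow> p \<le> q \<or> q \<le> p"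
    using assms(3) unfolding order_complex_iff[OF fin] by blast+
  have le: "q \<in> P \<and> q \<le> \<psi> g p" if "act g w q \<noteq> 0" for q
    by (rule act_nonzero[OF assms(1) that]) (use w(2) assms(1,2) \<psi>_mono \<psi>_closed in auto)
  show ?thesis
    unfolding order_complex_iff[OF fin]
  proof (intro conjI allI impI)
    show "0 \<le> act g w q" for q using w(1) by (simp add: act_def)
    show "q \<in> {r \<in> P. r \<le> \<psi> g p}" if "act g w q \<noteq> 0" for q using le[OF that] by simp
    show "q \<le> q' \<or> q' \<le> q" if "act g w q \<noteq> 0" "act g w q' \<noteq> 0" for q q'
    proof -
      obtain r where r: "r \<in> P" "w r \<noteq> 0" "q = \<psi> g r" using act_nonzero[OF assms(1) \<open>act g w q \<noteq> 0\<close>] .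
      obtain r' where r': "r' \<in> P" "w r' \<noteq> 0" "q' = \<psi> g r'"
        using act_nonzero[OF assms(1) \<open>act g w q' \<noteq> 0\<close>] .
      show ?thesis using w(3)[OF r(2) r'(2)] r r' \<psi>_mono[OF assms(1)] by blast
    qed
    \<comment> \<open>The sum is extended to all of \<open>P\<close> because \<open>P\<close>,
      unlike the part below \<open>p\<close>, is permuted by \<open>g\<close>.\<close>
    have "sum (act g w) {r \<in> P. r \<le> \<psi> g p} = sum (act g w) P"
      using le finite_P by (intro sum.mono_neutral_left) auto
    also have "\<dots> = sum w P" by (rule sum_act) (use assms \<psi>_closed in auto)
    also have "\<dots> = 1" using assms(3) by (rule sum_order_complex) (use finite_P in auto)
    finally show "sum (act g w) {r \<in> P. r \<le> \<psi> g p} = 1" .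
  qed
qed

text \<open>The support condition enters because \<open>act\<close> erases every coordinate outside
  \<open>P\<close>.\<close>

lemma act_inv:
  assumes "g \<in> carrier G" "\<And>p. w p \<noteq> 0 \<Longrightarrow> p \<in> P"
  shows "act (inv g) (act g w) = w"
proof
  fix q show "act (inv g) (act g w) q = w q"
    using assms by (cases "q \<in> P") (auto simp: act_def \<psi>_closed \<psi>_inv)
qed

text \<open>On representatives \<open>g\<close> is inverted by \<open>inv g\<close>, and by
  \<open>\<gamma>_d\<close> it carries identifications to identifications, so
  \<open>image_quot_class\<close> applies.\<close>

lemma hocolim_action_class:
  assumes "g \<in> carrier G" "p \<in> P" "w \<in> topspace (order_complex {r \<in> P. r \<le> p})"
    and "x \<in> topspace (D p)"
  shows "hocolim_action G P \<psi> \<gamma> g (hocolim_class P D d p w x) =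
    hocolim_class P D d (\<psi> g p) (act g w) (\<gamma> g p x)"
proof -
  let ?h = "\<lambda>g (p, w, x). (\<psi> g p, act g w, \<gamma> g p x)"
  have h: "?h g z \<in> topspace (pre_hocolim P D) \<and> ?h (inv g) (?h g z) = z"
    if "g \<in> carrier G" "z \<in> topspace (pre_hocolim P D)" for g z
  proof -
    obtain p w x where z: "z = (p, w, x)" by (rule prod_cases3)
    then have zz: "p \<in> P" "w \<in> topspace (order_complex {r \<in> P. r \<le> p})" "x \<in> topspace (D p)"
      using that by (simp_all add: topspace_pre_hocolim_iff)
    have "\<And>p. w p \<noteq> 0 \<Longrightarrow> p \<in> P" using zz(2) finite_P by (auto simp: order_complex_iff)
    then show ?thesis
      unfolding z using zz that(1)
      by (simp add: topspace_pre_hocolim_iff act_in_order_complex act_inv \<psi>_closed \<psi>_inv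
          \<gamma>_closed \<gamma>_inv)
  qed
  have r: "(?h g a, ?h g b) \<in> hocolim_rel P D d"
    if "g \<in> carrier G" "(a, b) \<in> hocolim_rel P D d" for g a b
  proof -
    obtain p q w y where "a = (q, w, y)" "b = (p, w, d p q y)" "p \<in> P" "q \<in> P" "p \<le> q"
        "w \<in> topspace (order_complex {r \<in> P. r \<le> p})" "y \<in> topspace (D q)"
      using \<open>(a, b) \<in> hocolim_rel P D d\<close> unfolding hocolim_rel_def by blast
    then show ?thesis
      unfolding hocolim_rel_def using that(1)
      by (auto simp: \<gamma>_d intro!: \<psi>_closed \<psi>_mono act_in_order_complex \<gamma>_closed)
  qed
  have "?h g ` quot_class (pre_hocolim P D) (hocolim_rel P D d) (p, w, x) =
      quot_class (pre_hocolim P D) (hocolim_rel P D d) (?h g (p, w, x))"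
  proof (rule image_quot_class[where k = "?h (inv g)"])
    fix z assume z: "z \<in> topspace (pre_hocolim P D)"
    show "?h (inv g) z \<in> topspace (pre_hocolim P D) \<and> ?h g (?h (inv g) z) = z"
      using h[of "inv g" z] z assms(1) by simp
    show "?h g z \<in> topspace (pre_hocolim P D) \<and> ?h (inv g) (?h g z) = z"
      by (rule h[OF assms(1) z])
  next
    show "(p, w, x) \<in> topspace (pre_hocolim P D)" using assms by (simp add: topspace_pre_hocolim_iff)
  qed (rule r; use assms(1) in simp)+
  then show ?thesis
    by (simp add: hocolim_action_def hocolim_class_def act_def)
qed

lemma equivariant_diagram_subset:
  assumes "Q \<subseteq> P" "\<And>g q. g \<in> carrier G \<Longrightarrow> q \<in> Q \<Longrightarrow> \<psi> g q \<in> Q"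
  shows "equivariant_diagram G Q \<psi> D d \<gamma>"
proof -
  have P: "q \<in> P" if "q \<in> Q" for q using assms(1) that by (rule subsetD)
  show ?thesis
    by (unfold_locales; (fact finite_subset[OF assms(1) finite_P])?;
        (simp add: assms(2) \<psi>_inv \<psi>_mono d_continuous d_id d_comp \<gamma>_closed \<gamma>_inv \<gamma>_d P)?)
qed

end

lemma equivariant_diagramI:
  assumes "group G" "finite P" "G_poset G P \<psi>" "G_diagram G P \<psi> D d \<gamma>"
  shows "equivariant_diagram G P \<psi> D d \<gamma>"
proof -
  interpret group G by fact
  interpret pos: group_action G P "\<lambda>g. restrict (\<psi> g) P"
    using assms(3) by (simp add: G_poset_def)
  let ?S = "topspace (sum_topology D P)"
  interpret dia: group_action G ?S "\<lambda>g. restrict (\<lambda>(p, x). (\<psi> g p, \<gamma> g p x)) ?S"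
    using assms(4) by (simp add: G_diagram_def)
  have \<psi>_closed: "\<psi> g p \<in> P" if "g \<in> carrier G" "p \<in> P" for g p
    using pos.element_image[OF that refl] that by simp
  have \<gamma>_closed: "\<gamma> g p x \<in> topspace (D (\<psi> g p))"
    if "g \<in> carrier G" "p \<in> P" "x \<in> topspace (D p)" for g p x
    using assms(4) that by (auto simp: G_diagram_def continuous_map_def)
  show ?thesis
  proof unfold_locales
    show "finite P" by fact
    show "\<psi> (inv\<^bsub>G\<^esub> g) (\<psi> g p) = p" if "g \<in> carrier G" "p \<in> P" for g p
      using pos.orbit_sym_aux[OF that refl] that \<psi>_closed[OF that] by simp
    show "\<gamma> (inv\<^bsub>G\<^esub> g) (\<psi> g p) (\<gamma> g p x) = x"
      if "g \<in> carrier G" "p \<in> P" "x \<in> topspace (D p)" for g p x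
    proof -
      \<comment> \<open>The action is given on the coproduct, so the inverse law for
        \<open>\<gamma>\<close> is the second component of the inverse law for pairs.\<close>
      have "(p, x) \<in> ?S" using that by simp
      from dia.orbit_sym_aux[OF that(1) this refl] show ?thesis
        using that \<psi>_closed[OF that(1,2)] \<gamma>_closed[OF that] by simp
    qed
  qed (use assms(3,4) \<psi>_closed \<gamma>_closed in \<open>simp_all add: G_poset_def G_diagram_def diagram_def\<close>)
qed

section \<open>Splitting a homotopy colimit along a partition of the poset\<close>

context equivariant_diagram
begin

definition part_point :: "'p set \<Rightarrow> 'p \<Rightarrow> ('p \<Rightarrow> real) \<Rightarrow> 'x \<Rightarrow> ('p, 'x) hocolim_point" where
  "part_point Q p w x = hocolim_class Q D d (top_vertex Q w) (normalized_restriction Q w)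
     (d (top_vertex Q w) p x)"

lemma finite_below: "finite {r \<in> P. r \<le> p}"
  using finite_P by simp

lemma top_vertex_below:
  assumes "Q \<subseteq> P" "w \<in> topspace (order_complex {r \<in> P. r \<le> p})" "sum w Q \<noteq> 0"
  shows "top_vertex Q w \<in> Q" "top_vertex Q w \<in> P" "top_vertex Q w \<le> p"
    "w (top_vertex Q w) \<noteq> 0" "\<And>q. q \<in> Q \<Longrightarrow> w q \<noteq> 0 \<Longrightarrow> q \<le> top_vertex Q w"
  using top_vertex[OF finite_below assms(2) finite_subset[OF assms(1) finite_P] assms(3)] assms(1)
  by auto

text \<open>The top vertex depends on \<open>w\<close> alone and lies below \<open>p\<close>, so
  moving \<open>y\<close> down to \<open>p\<close> first does not change where it ends.\<close>

lemma part_point_structure_map: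
  assumes "Q \<subseteq> P" "p \<in> P" "q \<in> P" "p \<le> q" "w \<in> topspace (order_complex {r \<in> P. r \<le> p})"
    and "y \<in> topspace (D q)" "sum w Q \<noteq> 0"
  shows "part_point Q p w (d p q y) = part_point Q q w y"
  using top_vertex_below[OF assms(1,5,7)] assms by (simp add: part_point_def d_comp)

text \<open>With a fixed vertex \<open>m\<close> in place of the top vertex, which jumps as
  \<open>w\<close> varies, the formula is a composite of continuous maps.\<close>

lemma continuous_map_cell:
  assumes "c \<subseteq> {r \<in> Q. r \<le> m}" "m \<in> Q" "Q \<subseteq> P" "p \<in> P" "m \<le> p"
  shows "continuous_map (prod_topology (order_complex c) (D p)) (hocolim Q D d)
    (\<lambda>(v, x). hocolim_class Q D d m v (d m p x))"
proof -
  have "m \<in> P" using assms by blast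
  then have "continuous_map (prod_topology (order_complex c) (D p)) (D m) (\<lambda>z. d m p (snd z))"
    using continuous_map_compose[OF continuous_map_snd d_continuous[of m p]] assms
    by (simp add: o_def)
  moreover have "continuous_map (prod_topology (order_complex c) (D p))
      (order_complex {r \<in> Q. r \<le> m}) fst"
  proof (rule continuous_map_into_fulltopology)
    show "continuous_map (prod_topology (order_complex c) (D p))
       (subtopology (order_complex {r \<in> Q. r \<le> m}) (topspace (order_complex c))) fst"
      unfolding order_complex_mono[OF assms(1), symmetric] by (rule continuous_map_fst)
  qed
  ultimately have "continuous_map (prod_topology (order_complex c) (D p))
      (prod_topology (order_complex {r \<in> Q. r \<le> m}) (D m)) (\<lambda>z. (fst z, d m p (snd z)))"
    by (rule continuous_map_paired[THEN iffD2, OF conjI, rotated])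
  from continuous_map_compose[OF this continuous_map_hocolim_class[OF assms(2), of D d]]
  show ?thesis by (simp add: o_def case_prod_unfold)
qed

context
  fixes Q
  assumes Q: "Q \<subseteq> P" "\<And>g q. g \<in> carrier G \<Longrightarrow> q \<in> Q \<Longrightarrow> \<psi> g q \<in> Q"
begin

interpretation sub: equivariant_diagram G Q \<psi> D d \<gamma>
  using Q by (rule equivariant_diagram_subset)

text \<open>Monotonicity makes \<open>g\<close> carry the top vertex of \<open>w\<close> to that of
  \<open>act g w\<close>; invariance of the weight on \<open>Q\<close> makes normalising commute
  with \<open>g\<close>, and \<open>\<gamma>_d\<close> moves \<open>g\<close> past the structure
  map.\<close>

lemma part_point_action:
  assumes "g \<in> carrier G" "p \<in> P" "w \<in> topspace (order_complex {r \<in> P. r \<le> p})"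
    and "x \<in> topspace (D p)" "sum w Q \<noteq> 0"
  shows "hocolim_action G Q \<psi> \<gamma> g (part_point Q p w x) =
    part_point Q (\<psi> g p) (act g w) (\<gamma> g p x)"
proof -
  note t = top_vertex_below[OF Q(1) assms(3,5)]
  have "top_vertex Q (act g w) = \<psi> g (top_vertex Q w)"
  proof (rule top_vertex_eqI)
    show "\<psi> g (top_vertex Q w) \<in> Q" using assms(1) t(1) by (rule Q(2))
    show "act g w (\<psi> g (top_vertex Q w)) \<noteq> 0" using assms(1) t by (simp add: act_\<psi>)
    fix q assume q: "q \<in> Q" "act g w q \<noteq> 0"
    obtain r where r: "r \<in> P" "w r \<noteq> 0" "q = \<psi> g r" using act_nonzero[OF assms(1) q(2)] .
    \<comment> \<open>Invariance of \<open>Q\<close> is used here for \<open>inv g\<close>.\<close>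
    have "r \<in> Q" using Q(2)[of "inv g" q] q(1) assms(1) r \<psi>_inv by simp
    then have "r \<le> top_vertex Q w" using t(5) r(2) by blast
    then show "q \<le> \<psi> g (top_vertex Q w)" unfolding r(3) using assms(1) r(1) t(2) by (simp add: \<psi>_mono)
  qed
  moreover have sum: "sum (act g w) Q = sum w Q"
    using assms(1) Q by (rule sum_act)
  have "normalized_restriction Q (act g w) = sub.act g (normalized_restriction Q w)"
  proof
    fix q
    have "\<psi> (inv g) q \<in> Q" if "q \<in> Q" using Q(2)[of "inv g" q] assms(1) that by simp
    then show "normalized_restriction Q (act g w) q = sub.act g (normalized_restriction Q w) q"
      using Q(1) by (auto simp: normalized_restriction_def sum) (auto simp: act_def sub.act_def)
  qed
  ultimately show ?thesis
    unfolding part_point_def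
    using sub.hocolim_action_class[OF assms(1) t(1)
        normalized_restriction_in_order_complex[OF finite_below assms(3) sub.finite_P assms(5)]
        d_closed[OF t(2) assms(2) t(3) assms(4)]]
      \<gamma>_d[OF assms(1) t(2) assms(2) t(3) assms(4)]
    by simp
qed

lemma part_point_in_hocolim:
  assumes "p \<in> P" "w \<in> topspace (order_complex {r \<in> P. r \<le> p})"
    and "x \<in> topspace (D p)" "sum w Q \<noteq> 0"
  shows "part_point Q p w x \<in> topspace (hocolim Q D d)"
proof -
  note t = top_vertex_below[OF Q(1) assms(2,4)]
  have "continuous_map (prod_topology (order_complex {r \<in> Q. r \<le> top_vertex Q w})
      (D (top_vertex Q w))) (hocolim Q D d)
      (\<lambda>(v, x). hocolim_class Q D d (top_vertex Q w) v x)"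
    by (rule continuous_map_hocolim_class[OF t(1)])
  then show ?thesis
    unfolding part_point_def
    using normalized_restriction_in_order_complex[OF finite_below assms(2) sub.finite_P assms(4)]
      d_closed[OF t(2) assms(1) t(3) assms(3)]
    by (force simp: continuous_map_def)
qed

text \<open>The scale \<open>s\<close> cancels on normalising. The top vertex may lie strictly below
  \<open>m\<close>, when \<open>v\<close> vanishes at \<open>m\<close>, but the identification along
  the structure map makes the two classes equal. So on a simplex the varying vertex can be replaced
  by the constant \<open>m\<close>.\<close>

lemma part_point_cell:
  assumes c: "c \<subseteq> Q" "m \<in> c" "\<And>r. r \<in> c \<Longrightarrow> r \<le> m" and p: "p \<in> P" "m \<le> p"
    and v: "v \<in> topspace (order_complex c)" and s: "s \<noteq> 0" "\<And>q. q \<in> Q \<Longrightarrow> w q = s * v q"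
    and x: "x \<in> topspace (D p)"
  shows "part_point Q p w x = hocolim_class Q D d m v (d m p x)"
proof -
  have finc: "finite c" using c(1) sub.finite_P by (rule finite_subset)
  have sumv: "sum v Q = 1" by (rule sum_order_complex[OF v c(1) sub.finite_P])
  then have sumv0: "sum v Q \<noteq> 0" by simp
  have sumw: "sum w Q = s" using s(2) sumv by (simp add: sum_distrib_left[symmetric])
  have v0: "q \<in> c" if "v q \<noteq> 0" for q using v that by (simp add: order_complex_iff[OF finc])
  have vn: "normalized_restriction Q v = v"
  proof
    fix q show "normalized_restriction Q v q = v q"
      using v0[of q] c(1) sumv by (auto simp: normalized_restriction_def)
  qed
  have wn: "normalized_restriction Q w = v"
  proof
    fix q show "normalized_restriction Q w q = v q"
      using v0[of q] c(1) sumw s by (auto simp: normalized_restriction_def)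
  qed
  \<comment> \<open>Since \<open>s\<close> is nonzero, \<open>w\<close> and \<open>v\<close> have
    the same support within \<open>Q\<close>.\<close>
  have "top_vertex Q w = top_vertex Q v"
    unfolding top_vertex_def using s by (intro arg_cong[where f = Greatest]) auto
  note t = top_vertex[OF finc v sub.finite_P sumv0, folded this]
  have vt: "v \<in> topspace (order_complex {r \<in> Q. r \<le> top_vertex Q w})"
    using normalized_restriction_in_order_complex[OF finc v sub.finite_P sumv0]
    unfolding vn \<open>top_vertex Q w = top_vertex Q v\<close> .
  have m: "m \<in> Q" "m \<in> P" "top_vertex Q w \<in> P" "top_vertex Q w \<le> m"
    using c t Q(1) by auto
  have "d (top_vertex Q w) p x = d (top_vertex Q w) m (d m p x)"
    using m p x by (simp add: d_comp)
  then show ?thesis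
    unfolding part_point_def wn
    using sub.hocolim_class_structure_map[OF t(1) m(1) m(4) vt d_closed[OF m(2) p x]] by simp
qed

end

end

section \<open>A simplex as the join of two opposite faces\<close>

text \<open>The orientation agrees with \<open>join_rel\<close>: \<open>t = 0\<close> gives the
  point \<open>v\<close> and \<open>t = 1\<close> the point \<open>v'\<close>.\<close>

definition chain_mix :: "real \<Rightarrow> ('p \<Rightarrow> real) \<Rightarrow> ('p \<Rightarrow> real) \<Rightarrow> 'p \<Rightarrow> real" where
  "chain_mix t v v' = (\<lambda>p. (1 - t) * v p + t * v' p)"

lemma finite_chain_has_max:
  fixes c :: "'p::order set"
  assumes "finite c" "c \<noteq> {}" "Complete_Partial_Order.chain (\<le>) c"
  obtains m where "m \<in> c" "\<And>r. r \<in> c \<Longrightarrow> r \<le> m"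
proof -
  obtain m where m: "m \<in> c" "\<And>b. b \<in> c \<Longrightarrow> m \<le> b \<Longrightarrow> m = b"
    using finite_has_maximal[OF assms(1,2)] by auto
  have "r \<le> m" if "r \<in> c" for r
    using m assms(3) that unfolding chain_def by blast
  with m(1) show ?thesis using that by blast
qed

text \<open>
  The parametrisation of a simplex as a join of two opposite faces is a quotient map even after
  taking the product with an arbitrary space, because its source is compact. This is what makes
  maps into the join, which carries the quotient topology, continuous.
\<close>

lemma quotient_map_chain_mix:
  fixes c0 c1 :: "'p::order set" and Z :: "'z topology"
  assumes fin: "finite (c0 \<union> c1)" and chain: "Complete_Partial_Order.chain (\<le>) (c0 \<union> c1)"
    and ne: "c0 \<noteq> {}" "c1 \<noteq> {}" and disj: "c0 \<inter> c1 = {}"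
  shows "quotient_map
     (prod_topology (prod_topology (order_complex c0)
        (prod_topology (order_complex c1) (top_of_set {0..1}))) Z)
     (prod_topology (order_complex (c0 \<union> c1)) Z)
     (\<lambda>((v, v', t), x). (chain_mix t v v', x))"
    (is "quotient_map (prod_topology ?K Z) (prod_topology ?L Z) _")
proof -
  have fin0: "finite c0" "finite c1" using fin by auto
  have chain0: "Complete_Partial_Order.chain (\<le>) c0" "Complete_Partial_Order.chain (\<le>) c1"
    using chain by (auto simp: chain_def)
  let ?f = "\<lambda>(v, v', t). chain_mix t v v'"
  have mem: "v \<in> topspace (order_complex c) \<longleftrightarrow>
     (\<forall>p. 0 \<le> v p) \<and> (\<forall>p. v p \<noteq> 0 \<longrightarrow> p \<in> c) \<and> sum v c = 1"
    if "finite c" "Complete_Partial_Order.chain (\<le>) c" for c :: "'p set" and v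
    unfolding order_complex_iff[OF that(1)] using that(2) by (auto simp: chain_def)
  have compact: "compact_space ?K"
    using compact_space_order_complex_chain[OF fin0(1) chain0(1)]
      compact_space_order_complex_chain[OF fin0(2) chain0(2)]
    by (simp add: compact_space_prod_topology compact_space_subtopology)
  have cont: "continuous_map ?K ?L ?f"
  proof (rule continuous_map_into_order_complex)
    fix p
    have "continuous_map ?K euclideanreal (\<lambda>z. fst z p)" "continuous_map ?K euclideanreal (\<lambda>z. fst (snd z) p)"
      "continuous_map ?K euclideanreal (\<lambda>z. snd (snd z))"
      using continuous_map_compose[OF continuous_map_fst continuous_map_order_complex_coordinate]
        continuous_map_compose[OF continuous_map_compose[OF continuous_map_snd continuous_map_fst]
          continuous_map_order_complex_coordinate]
        continuous_map_into_fulltopology[OF continuous_map_compose[OF continuous_map_snd continuous_map_snd]]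
      by (simp_all add: o_def)
    then show "continuous_map ?K euclideanreal (\<lambda>z. ?f z p)"
      by (simp add: case_prod_unfold chain_mix_def continuous_intros)
  next
    fix z assume "z \<in> topspace ?K"
    then obtain v v' t where z: "z = (v, v', t)" and v: "v \<in> topspace (order_complex c0)"
      and v': "v' \<in> topspace (order_complex c1)" and t: "0 \<le> t" "t \<le> 1" by auto
    have "sum (chain_mix t v v') (c0 \<union> c1) = (1 - t) * sum v (c0 \<union> c1) + t * sum v' (c0 \<union> c1)"
      by (simp add: chain_mix_def sum.distrib sum_distrib_left)
    also have "\<dots> = 1"
      using sum_order_complex[OF v _ fin] sum_order_complex[OF v' _ fin] by simp
    finally show "?f z \<in> topspace ?L"
      using v v' t unfolding z mem[OF fin chain] mem[OF fin0(1) chain0(1)] mem[OF fin0(2) chain0(2)]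
      by (force simp: chain_mix_def)
  qed
  have surj: "w \<in> ?f ` topspace ?K" if w: "w \<in> topspace ?L" for w
  proof -
    obtain a b where ab: "a \<in> c0" "b \<in> c1" using ne by blast
    define t where "t = sum w c1"
    have nonneg: "\<forall>p. 0 \<le> w p" and supp: "\<forall>p. w p \<noteq> 0 \<longrightarrow> p \<in> c0 \<union> c1" and "sum w (c0 \<union> c1) = 1"
      using w unfolding mem[OF fin chain] by blast+
    then have t0: "sum w c0 = 1 - t" using fin0 disj by (simp add: sum.union_disjoint t_def)
    \<comment> \<open>If the face \<open>c\<close> carries no weight, any point of it will do, as
      its coefficient is \<open>0\<close>; the vertex \<open>e\<close> is chosen. Otherwise the
      normalised restriction works.\<close>
    have face: "\<exists>v\<in>topspace (order_complex c). \<forall>p\<in>c. sum w c * v p = w p"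
      if "finite c" "Complete_Partial_Order.chain (\<le>) c" "e \<in> c" for c and e :: 'p
    proof (cases "sum w c = 0")
      case True
      have "(\<lambda>p. if p = e then 1 else 0) \<in> topspace (order_complex c)"
        using that by (simp add: mem)
      moreover have "\<forall>p\<in>c. w p = 0"
        using True nonneg that(1) by (simp add: sum_nonneg_eq_0_iff)
      ultimately show ?thesis using True by auto
    next
      case False
      have "normalized_restriction c w \<in> topspace (order_complex c)"
        using False nonneg that
        by (auto simp: mem normalized_restriction_def sum_nonneg sum_divide_distrib[symmetric])
      moreover have "\<forall>p\<in>c. sum w c * normalized_restriction c w p = w p"
        using False by (simp add: normalized_restriction_def)
      ultimately show ?thesis by blast
    qed
    obtain v where v: "v \<in> topspace (order_complex c0)" "\<forall>p\<in>c0. (1 - t) * v p = w p"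
      using face[OF fin0(1) chain0(1) ab(1)] unfolding t0 by blast
    obtain v' where v': "v' \<in> topspace (order_complex c1)" "\<forall>p\<in>c1. t * v' p = w p"
      using face[OF fin0(2) chain0(2) ab(2)] unfolding t_def by blast
    have v0: "v p = 0" if "p \<notin> c0" for p using v(1) that by (auto simp: mem fin0 chain0)
    have v'0: "v' p = 0" if "p \<notin> c1" for p using v'(1) that by (auto simp: mem fin0 chain0)
    have "w p = chain_mix t v v' p" for p
    proof -
      consider "p \<in> c0" "p \<notin> c1" | "p \<in> c1" "p \<notin> c0" | "p \<notin> c0 \<union> c1" using disj by blast
      then show ?thesis
      proof cases
        case 1 then show ?thesis using v(2) v'0 by (simp add: chain_mix_def)
      next
        case 2 then show ?thesis using v'(2) v0 by (simp add: chain_mix_def)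
      next
        case 3 then show ?thesis using supp v0 v'0 by (auto simp: chain_mix_def)
      qed
    qed
    then have "w = ?f (v, v', t)" by auto
    moreover have "0 \<le> t" "0 \<le> 1 - t"
      unfolding t0[symmetric] unfolding t_def using nonneg by (simp_all add: sum_nonneg)
    then have "(v, v', t) \<in> topspace ?K" using v(1) v'(1) by simp
    ultimately show ?thesis by (rule image_eqI)
  qed
  \<comment> \<open>A continuous map from a compact space to a Hausdorff space is proper.
    Properness, unlike being a quotient map, survives the product with the identity of any
    \<open>Z\<close>; and a proper map is closed.\<close>
  have "proper_map ?K ?L ?f"
    using compact Hausdorff_imp_kc_space[OF Hausdorff_space_order_complex] cont
    by (rule continuous_imp_proper_map)
  then have "proper_map (prod_topology ?K Z) (prod_topology ?L Z) (\<lambda>(k, x). (?f k, id x))"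
    unfolding proper_map_prod using proper_map_id[of Z] by (auto simp: id_def)
  then have "closed_map (prod_topology ?K Z) (prod_topology ?L Z) (\<lambda>(k, x). (?f k, x))"
    by (simp add: proper_imp_closed_map)
  moreover have "continuous_map (prod_topology ?K Z) (prod_topology ?L Z) (\<lambda>(k, x). (?f k, x))"
    using continuous_map_prod_top[of ?K Z ?L Z ?f "\<lambda>x. x"] cont by simp
  moreover have "(\<lambda>(k, x). (?f k, x)) ` topspace (prod_topology ?K Z) = topspace (prod_topology ?L Z)"
  proof (intro equalityI subsetI)
    fix y assume "y \<in> (\<lambda>(k, x). (?f k, x)) ` topspace (prod_topology ?K Z)"
    then show "y \<in> topspace (prod_topology ?L Z)"
      using continuous_map_image_subset_topspace[OF cont] by fastforce
  next
    fix y assume "y \<in> topspace (prod_topology ?L Z)"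
    then obtain w x where y: "y = (w, x)" "w \<in> topspace ?L" "x \<in> topspace Z" by auto
    obtain k where k: "w = ?f k" "k \<in> topspace ?K" using surj[OF y(2)] by (rule imageE)
    have "y = (\<lambda>(k, x). (?f k, x)) (k, x)" using y(1) k(1) by simp
    moreover have "(k, x) \<in> topspace (prod_topology ?K Z)" using k(2) y(3) by simp
    ultimately show "y \<in> (\<lambda>(k, x). (?f k, x)) ` topspace (prod_topology ?K Z)" by (rule image_eqI)
  qed
  ultimately have "quotient_map (prod_topology ?K Z) (prod_topology ?L Z) (\<lambda>(k, x). (?f k, x))"
    by (intro continuous_closed_imp_quotient_map)
  then show ?thesis by (simp add: case_prod_unfold)
qed

section \<open>The equivariant map from the homotopy colimit to the join\<close>

context equivariant_diagram
begin

context
  fixes P0 P1 :: "'p set"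
  assumes P01: "P0 \<union> P1 = P" "P0 \<inter> P1 = {}"
    and P0_inv: "\<And>g q. g \<in> carrier G \<Longrightarrow> q \<in> P0 \<Longrightarrow> \<psi> g q \<in> P0"
    and P1_inv: "\<And>g q. g \<in> carrier G \<Longrightarrow> q \<in> P1 \<Longrightarrow> \<psi> g q \<in> P1"
begin

lemma parts_subset: "P0 \<subseteq> P" "P1 \<subseteq> P"
  using P01(1) by auto

lemma sum_parts:
  assumes "w \<in> topspace (order_complex {r \<in> P. r \<le> p})"
  shows "sum w P0 + sum w P1 = 1"
proof -
  have fin: "finite P0" "finite P1" using parts_subset finite_P finite_subset by blast+
  have "sum w P = 1" using assms by (rule sum_order_complex) (use finite_P in auto)
  then show ?thesis
    using sum.union_disjoint[OF fin P01(2), of w] P01(1) by simp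
qed

lemma sum_part_nonneg: "w \<in> topspace (order_complex {r \<in> P. r \<le> p}) \<Longrightarrow> 0 \<le> sum w Q"
  by (simp add: order_complex_iff[OF finite_below] sum_nonneg)

text \<open>Where one part carries no weight its part point is meaningless, so the ends of the join
  are reached through the separate summands \<open>X\<close> and \<open>Y\<close>. This also covers
  an empty part.\<close>

definition pre_join_map ::
  "(('p, 'x) hocolim_point \<Rightarrow> 'a) \<Rightarrow> (('p, 'x) hocolim_point \<Rightarrow> 'b) \<Rightarrow>
    'p \<times> ('p \<Rightarrow> real) \<times> 'x \<Rightarrow> ('a + 'b) + 'a \<times> 'b \<times> real" where
  "pre_join_map f0 f1 = (\<lambda>(p, w, x).
     if sum w P1 = 0 then Inl (Inl (f0 (part_point P0 p w x)))
     else if sum w P0 = 0 then Inl (Inr (f1 (part_point P1 p w x)))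
     else Inr (f0 (part_point P0 p w x), f1 (part_point P1 p w x), sum w P1))"

context
  fixes X :: "'a topology" and Y :: "'b topology"
    and f0 :: "('p, 'x) hocolim_point \<Rightarrow> 'a" and f1 :: "('p, 'x) hocolim_point \<Rightarrow> 'b"
  assumes f0: "continuous_map (hocolim P0 D d) X f0" and f1: "continuous_map (hocolim P1 D d) Y f1"
begin

lemma pre_join_map_in_pre_join:
  assumes "p \<in> P" "w \<in> topspace (order_complex {r \<in> P. r \<le> p})" "x \<in> topspace (D p)"
  shows "pre_join_map f0 f1 (p, w, x) \<in> topspace (pre_join X Y)"
proof -
  have "f0 (part_point P0 p w x) \<in> topspace X" if "sum w P0 \<noteq> 0"
    using part_point_in_hocolim[OF parts_subset(1) P0_inv assms that] f0
    by (auto simp: continuous_map_def)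
  moreover have "f1 (part_point P1 p w x) \<in> topspace Y" if "sum w P1 \<noteq> 0"
    using part_point_in_hocolim[OF parts_subset(2) P1_inv assms that] f1
    by (auto simp: continuous_map_def)
  ultimately show ?thesis
    using sum_parts[OF assms(2)] sum_part_nonneg[OF assms(2), of P0]
      sum_part_nonneg[OF assms(2), of P1]
    by (auto simp: pre_join_map_def topspace_pre_join)
qed

text \<open>If the chain meets only one part, the map is a cell map followed by \<open>f0\<close> or
  \<open>f1\<close> and an inclusion into the join. If it meets both, the map is pulled back along
  \<open>chain_mix\<close>, where it becomes \<open>[h0, h1, t]\<close>; being continuous there, it
  is continuous on the simplex.\<close>

lemma continuous_map_join_map_simplex:
  assumes p: "p \<in> P" and c: "c \<subseteq> {r \<in> P. r \<le> p}" "Complete_Partial_Order.chain (\<le>) c"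
  shows "continuous_map (prod_topology (order_complex c) (D p)) (join_space X Y)
    (\<lambda>(w, x). join_class X Y (pre_join_map f0 f1 (p, w, x)))"
proof -
  define c0 c1 where "c0 = c \<inter> P0" and "c1 = c \<inter> P1"
  have c01: "c0 \<union> c1 = c" "c0 \<inter> c1 = {}" "c0 \<subseteq> P0" "c1 \<subseteq> P1" "P0 \<inter> c1 = {}" "P1 \<inter> c0 = {}"
    using c(1) P01 by (auto simp: c0_def c1_def)
  have finc: "finite c" using c(1) finite_below by (rule finite_subset)
  have fin: "finite P0" "finite P1" "finite c0" "finite c1"
    using parts_subset finite_P finc finite_subset by (auto simp: c0_def c1_def)
  have chain: "Complete_Partial_Order.chain (\<le>) c0" "Complete_Partial_Order.chain (\<le>) c1"
    using c(2) by (auto simp: chain_def c0_def c1_def)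
  have sum1: "sum v Q = 1" if "v \<in> topspace (order_complex b)" "b \<subseteq> Q" "finite Q"
    for v :: "'p \<Rightarrow> real" and b Q using that by (rule sum_order_complex)
  have sum0: "sum v Q = 0" if "v \<in> topspace (order_complex b)" "finite b" "Q \<inter> b = {}"
    for v :: "'p \<Rightarrow> real" and b Q
    by (rule sum.neutral) (use that in \<open>auto simp: order_complex_iff\<close>)
  have below: "m \<le> p" if "m \<in> c0 \<union> c1" for m
    using that c(1) c01 by auto
  have max: "\<exists>m\<in>b. \<forall>r\<in>b. r \<le> m" if "finite b" "b \<noteq> {}" "Complete_Partial_Order.chain (\<le>) b"
    for b :: "'p set" using finite_chain_has_max[OF that] by metis
  note Inl = continuous_map_Inl and Inr = continuous_map_Inr
  note cell0 = part_point_cell[OF parts_subset(1) P0_inv c01(3)]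
  note cell1 = part_point_cell[OF parts_subset(2) P1_inv c01(4)]
  consider "c1 = {}" "c0 = {}" | "c1 = {}" "c0 \<noteq> {}" | "c0 = {}" "c1 \<noteq> {}" | "c0 \<noteq> {}" "c1 \<noteq> {}" by blast
  then show ?thesis
  proof cases
    case 1
    then have "c = {}" using c01 by simp
    \<comment> \<open>An empty sum cannot be \<open>1\<close>.\<close>
    then have "topspace (order_complex c) = {}"
      unfolding set_eq_iff order_complex_iff[OF finc] by simp
    then have "order_complex c = trivial_topology" by simp
    then show ?thesis by simp
  next
    case 2
    then obtain m where m: "m \<in> c0" "\<And>r. r \<in> c0 \<Longrightarrow> r \<le> m" using max[OF fin(3) _ chain(1)] by metis
    have mP: "m \<in> P0" "m \<le> p" "c0 \<subseteq> {r \<in> P0. r \<le> m}" using m c01 below by auto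
    have "c = c0" using 2 c01 by simp
    from continuous_map_compose[OF continuous_map_compose[OF
          continuous_map_cell[OF mP(3,1) parts_subset(1) p mP(2)] f0]
        continuous_map_compose[OF continuous_map_compose[OF Inl Inl]
          continuous_map_join_class[of X Y, unfolded pre_join_def]]]
    show ?thesis
      unfolding \<open>c = c0\<close>
    proof (rule continuous_map_eq)
      fix z assume "z \<in> topspace (prod_topology (order_complex c0) (D p))"
      then obtain w x where z: "z = (w, x)" "w \<in> topspace (order_complex c0)" "x \<in> topspace (D p)"
        by auto
      then show "(join_class X Y \<circ> (Inl \<circ> Inl) \<circ>
           (f0 \<circ> (\<lambda>(v, x). hocolim_class P0 D d m v (d m p x)))) z =
         (case z of (w, x) \<Rightarrow> join_class X Y (pre_join_map f0 f1 (p, w, x)))"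
        using cell0[OF _ _ m p mP(2) z(2), of 1 w x] sum0[OF z(2) fin(3) c01(6)]
        by (simp add: pre_join_map_def)
    qed
  next
    case 3
    then obtain m where m: "m \<in> c1" "\<And>r. r \<in> c1 \<Longrightarrow> r \<le> m" using max[OF fin(4) _ chain(2)] by metis
    have mP: "m \<in> P1" "m \<le> p" "c1 \<subseteq> {r \<in> P1. r \<le> m}" using m c01 below by auto
    have "c = c1" using 3 c01 by simp
    from continuous_map_compose[OF continuous_map_compose[OF
          continuous_map_cell[OF mP(3,1) parts_subset(2) p mP(2)] f1]
        continuous_map_compose[OF continuous_map_compose[OF Inr Inl]
          continuous_map_join_class[of X Y, unfolded pre_join_def]]]
    show ?thesis
      unfolding \<open>c = c1\<close>
    proof (rule continuous_map_eq)
      fix z assume "z \<in> topspace (prod_topology (order_complex c1) (D p))"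
      then obtain w x where z: "z = (w, x)" "w \<in> topspace (order_complex c1)" "x \<in> topspace (D p)"
        by auto
      then show "(join_class X Y \<circ> (Inl \<circ> Inr) \<circ>
           (f1 \<circ> (\<lambda>(v, x). hocolim_class P1 D d m v (d m p x)))) z =
         (case z of (w, x) \<Rightarrow> join_class X Y (pre_join_map f0 f1 (p, w, x)))"
        using cell1[OF _ _ m p mP(2) z(2), of 1 w x] sum0[OF z(2) fin(4) c01(5)]
          sum1[OF z(2) c01(4) fin(2)]
        by (simp add: pre_join_map_def)
    qed
  next
    case 4
    obtain m0 where m0: "m0 \<in> c0" "\<And>r. r \<in> c0 \<Longrightarrow> r \<le> m0" using 4 max[OF fin(3) _ chain(1)] by metis
    have mP0: "m0 \<in> P0" "m0 \<le> p" "c0 \<subseteq> {r \<in> P0. r \<le> m0}" using m0 c01 below by auto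
    obtain m1 where m1: "m1 \<in> c1" "\<And>r. r \<in> c1 \<Longrightarrow> r \<le> m1" using 4 max[OF fin(4) _ chain(2)] by metis
    have mP1: "m1 \<in> P1" "m1 \<le> p" "c1 \<subseteq> {r \<in> P1. r \<le> m1}" using m1 c01 below by auto
    \<comment> \<open>Unlike the part points, \<open>h0\<close> and \<open>h1\<close> are defined
      for every \<open>t\<close>, including the ends.\<close>
    define h0 where "h0 = f0 \<circ> (\<lambda>(v, x). hocolim_class P0 D d m0 v (d m0 p x))"
    define h1 where "h1 = f1 \<circ> (\<lambda>(v, x). hocolim_class P1 D d m1 v (d m1 p x))"
    have h0: "continuous_map (prod_topology (order_complex c0) (D p)) X h0"
      unfolding h0_def
      by (rule continuous_map_compose[OF continuous_map_cell[OF mP0(3,1) parts_subset(1) p mP0(2)] f0])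
    have h1: "continuous_map (prod_topology (order_complex c1) (D p)) Y h1"
      unfolding h1_def
      by (rule continuous_map_compose[OF continuous_map_cell[OF mP1(3,1) parts_subset(2) p mP1(2)] f1])
    let ?S = "prod_topology (prod_topology (order_complex c0)
        (prod_topology (order_complex c1) (top_of_set {0..1 :: real}))) (D p)"
    have proj: "continuous_map ?S (order_complex c0) (\<lambda>z. fst (fst z))"
      "continuous_map ?S (order_complex c1) (\<lambda>z. fst (snd (fst z)))"
      "continuous_map ?S (top_of_set {0..1::real}) (\<lambda>z. snd (snd (fst z)))"
      "continuous_map ?S (D p) snd"
      by (intro continuous_map_fst_of continuous_map_snd_of continuous_map_fst continuous_map_snd
          continuous_map_fst[THEN continuous_map_compose, unfolded o_def]
          continuous_map_snd[THEN continuous_map_compose, unfolded o_def])+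
    have "continuous_map ?S (prod_topology X (prod_topology Y (top_of_set {0..1})))
        (\<lambda>z. (h0 (fst (fst z), snd z), h1 (fst (snd (fst z)), snd z), snd (snd (fst z))))"
      using continuous_map_compose[OF continuous_map_pairedI[OF proj(1,4)] h0]
        continuous_map_compose[OF continuous_map_pairedI[OF proj(2,4)] h1]
      unfolding o_def by (intro continuous_map_pairedI proj(3))
    from continuous_map_compose[OF this continuous_map_compose[OF Inr
          continuous_map_join_class[of X Y, unfolded pre_join_def]]]
    have "continuous_map ?S (join_space X Y)
        ((\<lambda>(w, x). join_class X Y (pre_join_map f0 f1 (p, w, x))) \<circ>
         (\<lambda>((v, v', t), x). (chain_mix t v v', x)))"
    proof (rule continuous_map_eq)
      fix z assume "z \<in> topspace ?S"
      then obtain v v' t x where z: "z = ((v, v', t), x)" and v: "v \<in> topspace (order_complex c0)"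
        and v': "v' \<in> topspace (order_complex c1)" and t: "0 \<le> t" "t \<le> 1" and x: "x \<in> topspace (D p)"
        by auto
      let ?w = "chain_mix t v v'"
      have v0: "v q = 0" if "q \<in> P1" for q
        using v c01(6) that by (auto simp: order_complex_iff[OF fin(3)])
      have v'0: "v' q = 0" if "q \<in> P0" for q
        using v' c01(5) that by (auto simp: order_complex_iff[OF fin(4)])
      have s0: "sum ?w P0 = 1 - t"
        using sum1[OF v c01(3) fin(1)] v'0 by (simp add: chain_mix_def flip: sum_distrib_left)
      have s1: "sum ?w P1 = t"
        using sum1[OF v' c01(4) fin(2)] v0 by (simp add: chain_mix_def flip: sum_distrib_left)
      \<comment> \<open>On \<open>P0\<close> the mixed point is \<open>1 - t\<close> times
        \<open>v\<close>, so \<open>part_point_cell\<close> applies with this scale, which is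
        nonzero.\<close>
      have e0: "f0 (part_point P0 p ?w x) = h0 (v, x)" if "t \<noteq> 1"
        unfolding h0_def using cell0[OF _ _ m0 p mP0(2) v, of "1 - t" ?w x] that v'0 x
        by (simp add: chain_mix_def)
      have e1: "f1 (part_point P1 p ?w x) = h1 (v', x)" if "t \<noteq> 0"
        unfolding h1_def using cell1[OF _ _ m1 p mP1(2) v', of t ?w x] that v0 x
        by (simp add: chain_mix_def)
      have mem: "h0 (v, x) \<in> topspace X" "h1 (v', x) \<in> topspace Y"
        using h0 h1 v v' x by (auto simp: continuous_map_def)
      \<comment> \<open>At the two ends one of \<open>h0\<close>, \<open>h1\<close> has no
        counterpart in \<open>pre_join_map\<close>, but the join identification forgets exactly that
        component.\<close>
      consider "t = 0" | "t = 1" | "t \<noteq> 0" "t \<noteq> 1" by blast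
      then have "join_class X Y (Inr (h0 (v, x), h1 (v', x), t)) =
          join_class X Y (pre_join_map f0 f1 (p, ?w, x))"
      proof cases
        case 1
        then have "pre_join_map f0 f1 (p, ?w, x) = Inl (Inl (h0 (v, x)))"
          using s1 e0 by (simp add: pre_join_map_def)
        then show ?thesis using 1 join_class_0[OF mem] by simp
      next
        case 2
        then have "pre_join_map f0 f1 (p, ?w, x) = Inl (Inr (h1 (v', x)))"
          using s0 s1 e1 by (simp add: pre_join_map_def)
        then show ?thesis using 2 join_class_1[OF mem] by simp
      next
        case 3
        then show ?thesis using s0 s1 e0 e1 by (simp add: pre_join_map_def)
      qed
      then show "(join_class X Y \<circ> Inr \<circ>
          (\<lambda>z. (h0 (fst (fst z), snd z), h1 (fst (snd (fst z)), snd z), snd (snd (fst z))))) z =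
        ((\<lambda>(w, x). join_class X Y (pre_join_map f0 f1 (p, w, x))) \<circ>
         (\<lambda>((v, v', t), x). (chain_mix t v v', x))) z"
        by (simp add: z)
    qed
    moreover have "quotient_map ?S (prod_topology (order_complex c) (D p))
        (\<lambda>((v, v', t), x). (chain_mix t v v', x))"
      using quotient_map_chain_mix[of c0 c1 "D p"] 4 c01(1,2) c(2) finc by simp
    ultimately show ?thesis by (rule continuous_compose_quotient_map[rotated])
  qed
qed

text \<open>The simplices over the finitely many chains below \<open>p\<close> give a finite closed
  cover. The local maps are restrictions of one function, so they agree on overlaps.\<close>

lemma continuous_map_join_map:
  assumes p: "p \<in> P"
  shows "continuous_map (prod_topology (order_complex {r \<in> P. r \<le> p}) (D p)) (join_space X Y)
    (\<lambda>(w, x). join_class X Y (pre_join_map f0 f1 (p, w, x)))"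
proof (rule pasting_lemma_closed)
  let ?I = "{c. c \<subseteq> {r \<in> P. r \<le> p} \<and> Complete_Partial_Order.chain (\<le>) c}"
  let ?T = "\<lambda>c. topspace (order_complex c) \<times> topspace (D p)"
  show "finite ?I" using finite_below by simp
  fix c assume c: "c \<in> ?I"
  then have "finite c" using finite_below finite_subset by blast
  with c show "closedin (prod_topology (order_complex {r \<in> P. r \<le> p}) (D p)) (?T c)"
    using closedin_order_complex_chain[of c "{r \<in> P. r \<le> p}"] by (simp add: closedin_prod_Times_iff)
  have "subtopology (prod_topology (order_complex {r \<in> P. r \<le> p}) (D p)) (?T c) =
      prod_topology (order_complex c) (D p)"
    using c order_complex_mono[of c "{r \<in> P. r \<le> p}"] by (simp add: subtopology_Times)
  then show "continuous_map (subtopology (prod_topology (order_complex {r \<in> P. r \<le> p}) (D p)) (?T c))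
      (join_space X Y) (\<lambda>(w, x). join_class X Y (pre_join_map f0 f1 (p, w, x)))"
    using continuous_map_join_map_simplex[OF p, of c] c by simp
next
  fix z assume "z \<in> topspace (prod_topology (order_complex {r \<in> P. r \<le> p}) (D p))"
  then obtain w x where z: "z = (w, x)" "w \<in> topspace (order_complex {r \<in> P. r \<le> p})"
    "x \<in> topspace (D p)" by auto
  \<comment> \<open>The support of \<open>w\<close> is itself a chain whose simplex contains
    \<open>w\<close>.\<close>
  let ?c = "{q. w q \<noteq> 0}"
  have c: "?c \<subseteq> {r \<in> P. r \<le> p}" "Complete_Partial_Order.chain (\<le>) ?c"
    using z(2) by (auto simp: order_complex_iff[OF finite_below] chain_def)
  moreover have "w \<in> topspace (order_complex ?c)" using z(2) by (auto simp: order_complex_def)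
  ultimately show "\<exists>c. c \<in> {c. c \<subseteq> {r \<in> P. r \<le> p} \<and> Complete_Partial_Order.chain (\<le>) c} \<and>
      z \<in> topspace (order_complex c) \<times> topspace (D p) \<and>
      (case z of (w, x) \<Rightarrow> join_class X Y (pre_join_map f0 f1 (p, w, x))) =
      (case z of (w, x) \<Rightarrow> join_class X Y (pre_join_map f0 f1 (p, w, x)))"
    using z by blast
qed simp

text \<open>An identification leaves \<open>w\<close> unchanged, and \<open>w\<close> alone decides
  the branch and the join parameter. The weights of the parts add to \<open>1\<close>, so every part
  point that occurs has nonzero weight and \<open>part_point_structure_map\<close> applies.\<close>

lemma join_map_hocolim_rel:
  assumes "(a, b) \<in> hocolim_rel P D d"
  shows "join_class X Y (pre_join_map f0 f1 a) = join_class X Y (pre_join_map f0 f1 b)"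
proof -
  obtain p q w y where ab: "a = (q, w, y)" "b = (p, w, d p q y)" and *: "p \<in> P" "q \<in> P" "p \<le> q"
      "w \<in> topspace (order_complex {r \<in> P. r \<le> p})" "y \<in> topspace (D q)"
    using assms unfolding hocolim_rel_def by blast
  show ?thesis
    using part_point_structure_map[OF parts_subset(1) *] part_point_structure_map[OF parts_subset(2) *]
      sum_parts[OF *(4)]
    by (auto simp: ab pre_join_map_def)
qed

definition join_map :: "('p, 'x) hocolim_point \<Rightarrow> ('a, 'b) join_point" where
  "join_map = lift (\<lambda>z. join_class X Y (pre_join_map f0 f1 z))"

lemma continuous_map_hocolim_join_map: "continuous_map (hocolim P D d) (join_space X Y) join_map"
  unfolding hocolim_eq join_map_def
proof (rule continuous_map_lift)
  show "continuous_map (pre_hocolim P D) (join_space X Y) (\<lambda>z. join_class X Y (pre_join_map f0 f1 z))"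
    unfolding pre_hocolim_def
    by (rule continuous_map_from_sum_topology)
      (use continuous_map_join_map in \<open>simp add: case_prod_unfold\<close>)
qed (rule join_map_hocolim_rel)

lemma join_map_class:
  assumes "p \<in> P" "w \<in> topspace (order_complex {r \<in> P. r \<le> p})" "x \<in> topspace (D p)"
  shows "join_map (hocolim_class P D d p w x) = join_class X Y (pre_join_map f0 f1 (p, w, x))"
  unfolding join_map_def hocolim_class_def
  by (rule lift_quot_class) (simp_all add: topspace_pre_hocolim_iff assms join_map_hocolim_rel)

end

text \<open>Both weights are invariant under \<open>g\<close>, so a point and its translate fall
  into the same branch with the same join parameter; the part points are translated by
  \<open>part_point_action\<close>.\<close>

lemma G_map_join_map:
  assumes X: "G_space G X \<phi>" and Y: "G_space G Y \<theta>"
    and f0: "G_map G (hocolim P0 D d) (hocolim_action G P0 \<psi> \<gamma>) X \<phi> f0"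
    and f1: "G_map G (hocolim P1 D d) (hocolim_action G P1 \<psi> \<gamma>) Y \<theta> f1"
  shows "G_map G (hocolim P D d) (hocolim_action G P \<psi> \<gamma>) (join_space X Y) (join_action \<phi> \<theta>)
    (join_map X Y f0 f1)"
  unfolding G_map_def
proof (intro conjI ballI)
  have c: "continuous_map (hocolim P0 D d) X f0" "continuous_map (hocolim P1 D d) Y f1"
    using f0 f1 by (simp_all add: G_map_def)
  show "continuous_map (hocolim P D d) (join_space X Y) (join_map X Y f0 f1)"
    using c by (rule continuous_map_hocolim_join_map)
  fix g C assume g: "g \<in> carrier G" and "C \<in> topspace (hocolim P D d)"
  then obtain p w x where C: "C = hocolim_class P D d p w x" and *: "p \<in> P"
    "w \<in> topspace (order_complex {r \<in> P. r \<le> p})" "x \<in> topspace (D p)"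
    by (elim hocolim_point_cases)
  have gz: "\<psi> g p \<in> P" "act g w \<in> topspace (order_complex {r \<in> P. r \<le> \<psi> g p})"
    "\<gamma> g p x \<in> topspace (D (\<psi> g p))"
    using g * by (simp_all add: \<psi>_closed act_in_order_complex \<gamma>_closed)
  have 0: "f0 (part_point P0 (\<psi> g p) (act g w) (\<gamma> g p x)) = \<phi> g (f0 (part_point P0 p w x))"
    if "sum w P0 \<noteq> 0"
    using f0 g part_point_in_hocolim[OF parts_subset(1) P0_inv * that]
      part_point_action[OF parts_subset(1) P0_inv g * that, symmetric]
    by (simp add: G_map_def)
  have 1: "f1 (part_point P1 (\<psi> g p) (act g w) (\<gamma> g p x)) = \<theta> g (f1 (part_point P1 p w x))"
    if "sum w P1 \<noteq> 0"
    using f1 g part_point_in_hocolim[OF parts_subset(2) P1_inv * that]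
      part_point_action[OF parts_subset(2) P1_inv g * that, symmetric]
    by (simp add: G_map_def)
  have "pre_join_map f0 f1 (\<psi> g p, act g w, \<gamma> g p x) =
      map_sum (map_sum (\<phi> g) (\<theta> g)) (\<lambda>(x, y, t). (\<phi> g x, \<theta> g y, t)) (pre_join_map f0 f1 (p, w, x))"
    using 0 1 sum_parts[OF *(2)] sum_act[OF g parts_subset(1) P0_inv, of w]
      sum_act[OF g parts_subset(2) P1_inv, of w]
    by (simp add: pre_join_map_def)
  then show "join_map X Y f0 f1 (hocolim_action G P \<psi> \<gamma> g C) =
      join_action \<phi> \<theta> g (join_map X Y f0 f1 C)"
    unfolding C hocolim_action_class[OF g *] join_map_class[OF c *] join_map_class[OF c gz]
    using join_action_join_class[OF is_group X Y g pre_join_map_in_pre_join[OF c *]] by simp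
qed

end

end

section \<open>Attained indices and the final inequality\<close>

text \<open>The infimum of a nonempty set in \<open>enat\<close> is its least element, hence
  attained by some map, while the empty set has infimum \<open>\<infinity>\<close>.\<close>

lemma Ind_finite_iff:
  "Ind G A \<alpha> X \<phi> \<noteq> \<infinity> \<longleftrightarrow> (\<exists>n f. Ind G A \<alpha> X \<phi> = enat n \<and> G_map G X \<phi> (A n) (\<alpha> n) f)"
proof
  assume fin: "Ind G A \<alpha> X \<phi> \<noteq> \<infinity>"
  let ?S = "{enat n | n. \<exists>f. G_map G X \<phi> (A n) (\<alpha> n) f}"
  have "?S \<noteq> {}"
  proof
    assume "?S = {}"
    with fin show False unfolding Ind_def by (simp add: Inf_enat_def)
  qed
  then obtain x where "x \<in> ?S" by blast
  then have "(LEAST x. x \<in> ?S) \<in> ?S" by (rule LeastI)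
  then have "Ind G A \<alpha> X \<phi> \<in> ?S" using \<open>?S \<noteq> {}\<close> by (simp add: Ind_def Inf_enat_def)
  then show "\<exists>n f. Ind G A \<alpha> X \<phi> = enat n \<and> G_map G X \<phi> (A n) (\<alpha> n) f" by blast
qed auto

lemma Ind_le: "G_map G X \<phi> (A n) (\<alpha> n) f \<Longrightarrow> Ind G A \<alpha> X \<phi> \<le> enat n"
  unfolding Ind_def by (rule Inf_lower) blast

lemma G_map_compose:
  assumes "G_map G X \<phi> Y \<theta> f" "G_map G Y \<theta> Z \<kappa> h"
  shows "G_map G X \<phi> Z \<kappa> (h \<circ> f)"
  using assms continuous_map_compose[of X Y f Z h] continuous_map_funspace[of X Y f]
  by (auto simp: G_map_def Pi_iff)

theorem proposition6p2:
  fixes G :: "('g, 'm) monoid_scheme"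
    and A :: "nat \<Rightarrow> 'a topology" and \<alpha> :: "nat \<Rightarrow> 'g \<Rightarrow> 'a \<Rightarrow> 'a"
    and P P0 P1 :: "'p::order set" and \<psi> :: "'g \<Rightarrow> 'p \<Rightarrow> 'p"
    and D :: "'p \<Rightarrow> 'x topology" and d :: "'p \<Rightarrow> 'p \<Rightarrow> 'x \<Rightarrow> 'x"
    and \<gamma> :: "'g \<Rightarrow> 'p \<Rightarrow> 'x \<Rightarrow> 'x"
  assumes "group G" and "finite (carrier G)"
    and "\<And>n. G_space G (A n) (\<alpha> n)"
    and "\<And>p q. \<exists>f. G_map G (join_space (A p) (A q)) (join_action (\<alpha> p) (\<alpha> q))
                      (A (p + q + 1)) (\<alpha> (p + q + 1)) f"
    and "finite P" and "G_poset G P \<psi>"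
    and "initial_subposet P P0" and "\<And>g. g \<in> carrier G \<Longrightarrow> \<psi> g ` P0 \<subseteq> P0"
    and "P1 = P - P0"
    and "G_diagram G P \<psi> D d \<gamma>"
  shows \<comment> \<open>The subtracted terms are moved to the other side, as \<open>\<infinity> - \<infinity>\<close> has no meaning for indices;
      whenever the difference is defined, the two forms say the same.\<close>
    "Ind G A \<alpha> (hocolim P D d) (hocolim_action G P \<psi> \<gamma>)
       \<le> Ind G A \<alpha> (hocolim P0 D d) (hocolim_action G P0 \<psi> \<gamma>)
         + Ind G A \<alpha> (hocolim P1 D d) (hocolim_action G P1 \<psi> \<gamma>) + 1"
proof -
  let ?I0 = "Ind G A \<alpha> (hocolim P0 D d) (hocolim_action G P0 \<psi> \<gamma>)"
  let ?I1 = "Ind G A \<alpha> (hocolim P1 D d) (hocolim_action G P1 \<psi> \<gamma>)"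
  interpret equivariant_diagram G P \<psi> D d \<gamma>
    using assms(1,5,6,10) by (rule equivariant_diagramI)
  have "P0 \<subseteq> P" using assms(7) by (simp add: initial_subposet_def)
  with assms(9) have parts: "P0 \<union> P1 = P" "P0 \<inter> P1 = {}" by auto
  have P0_inv: "\<psi> g q \<in> P0" if "g \<in> carrier G" "q \<in> P0" for g q
    using assms(8)[OF that(1)] that(2) by blast
  have P1_inv: "\<psi> g q \<in> P1" if "g \<in> carrier G" "q \<in> P1" for g q
  proof -
    have "q \<in> P" using that(2) parts by blast
    \<comment> \<open>Otherwise \<open>inv g\<close> would bring \<open>\<psi> g q\<close> back to
      \<open>q\<close> inside \<open>P0\<close>.\<close>
    then have "\<psi> g q \<notin> P0"
      using P0_inv[of "inv\<^bsub>G\<^esub> g" "\<psi> g q"] \<psi>_inv[OF that(1)] that parts by auto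
    with \<psi>_closed[OF that(1) \<open>q \<in> P\<close>] show ?thesis using assms(9) by simp
  qed
  show ?thesis
  proof (cases "?I0 = \<infinity> \<or> ?I1 = \<infinity>")
    case True
    then show ?thesis by auto
  next
    case False
    then obtain m f0 n f1 where m: "?I0 = enat m"
      and f0: "G_map G (hocolim P0 D d) (hocolim_action G P0 \<psi> \<gamma>) (A m) (\<alpha> m) f0"
      and n: "?I1 = enat n"
      and f1: "G_map G (hocolim P1 D d) (hocolim_action G P1 \<psi> \<gamma>) (A n) (\<alpha> n) f1"
      by (metis Ind_finite_iff)
    obtain j where "G_map G (join_space (A m) (A n)) (join_action (\<alpha> m) (\<alpha> n))
        (A (m + n + 1)) (\<alpha> (m + n + 1)) j"
      using assms(4) by blast
    \<comment> \<open>The extra \<open>1\<close> of the inequality comes from \<open>j\<close>,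
      which sends the join of \<open>A m\<close> and \<open>A n\<close> to
      \<open>A (m + n + 1)\<close>.\<close>
    then have "G_map G (hocolim P D d) (hocolim_action G P \<psi> \<gamma>) (A (m + n + 1)) (\<alpha> (m + n + 1))
        (j \<circ> join_map P0 P1 (A m) (A n) f0 f1)"
      by (rule G_map_compose[rotated]) (rule G_map_join_map[OF parts P0_inv P1_inv assms(3) assms(3) f0 f1])
    from Ind_le[of G _ _ A _ \<alpha>, OF this]
    show ?thesis by (simp add: m n one_enat_def)
  qed
qed

end
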